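(* Let $N\ge 1$. For every persistence diagram $P$ (of level zero), the space $data_P=\mathsf{Dgm}^{-1}(P)\subset \mathbb{R}^N$ is composed of a finite number of mutually disjoint (connected) components. Each component is contractible, and is homeomorphic to a finite union of convex, potentially unbounded polytopes.
   Context: $\mathcal{S}_N$ denotes the 1-dimensional simplicial complex with $N$ vertices $[i]$ ($i=1,\dots,N$) and $N-1$ edges $[i,i+1]$ ($i=1,\dots,N-1$), a simplicial decomposition of a closed bounded interval. For $z=(z_1,\dots,z_N)\in\mathbb{R}^N$ and a simplex $\sigma$ of $\mathcal{S}_N$ put $f(z,[j])=z_j$ and $f(z,[j,j+1])=\max\{z_j,z_{j+1}\}$, and for $r\in\mathbb{R}$ let $\mathcal{S}_N(z,r)=\{\sigma\in\mathcal{S}_N : f(z,\sigma)\le r\}$, a subcomplex of $\mathcal{S}_N$. Ordering the coordinates $z_{j_1}\le z_{j_2}\le\cdots\le z_{j_N}$, the sublevel-set filtration of $\mathcal{S}_N$ at $z$ is $\mathcal{S}_N(z,z_{j_1})\subseteq\cdots\subseteq\mathcal{S}_N(z,z_{j_N})$. $\mathsf{Dgm}(z)$ denotes the (level zero) persistence diagram of this filtration, i.e. the finite multiset of points (birth, death) $=(p^b,p^d)$, $p^b<p^d\le\infty$, of the degree-zero persistent homology $H_0$ (field coefficients) of the filtration $r\mapsto\mathcal{S}_N(z,r)$. $\mathsf{Per}$ denotes the set of all persistence diagrams of level zero, so $\mathsf{Dgm}:\mathbb{R}^N\to\mathsf{Per}$. For $P\in\mathsf{Per}$, $data_P=\mathsf{Dgm}^{-1}(P)$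 is the set of all $z\in\mathbb{R}^N$ with persistence diagram $P$, with the subspace topology from $\mathbb{R}^N$. *)

theory Defs
  imports "HOL-Analysis.Analysis" "HOL-Library.Function_Algebras" "HOL-Library.Multiset"
begin

section \<open>Simplicial homology with field coefficients\<close>

text \<open>A simplicial complex on ordered vertices is given by its set of nonempty simplices.
  A chain is a coefficient function on simplices; chains carry the pointwise addition of
  \<^theory>\<open>HOL-Library.Function_Algebras\<close> and the following scalar multiplication.\<close>

definition chain_scale :: "'k::field \<Rightarrow> (nat set \<Rightarrow> 'k) \<Rightarrow> (nat set \<Rightarrow> 'k)" where
  "chain_scale a c = (\<lambda>\<sigma>. a * c \<sigma>)"

lemma vector_space_chain_scale: "vector_space chain_scale"
  by unfold_locales (auto simp: chain_scale_def fun_eq_iff algebra_simps)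

definition chains :: "nat \<Rightarrow> nat set set \<Rightarrow> (nat set \<Rightarrow> 'k::field) set" where
  "chains p K = {c. \<forall>\<sigma>. c \<sigma> \<noteq> 0 \<longrightarrow> \<sigma> \<in> K \<and> card \<sigma> = Suc p}"

text \<open>The coefficient of \<open>\<tau>\<close> in the boundary of \<open>c\<close> collects the cofaces \<open>\<tau> \<union> {v}\<close>, with the sign
  given by the position of \<open>v\<close> in the increasing enumeration of \<open>\<tau> \<union> {v}\<close>. The empty set is not
  a simplex (unreduced homology).\<close>

definition boundary :: "nat set set \<Rightarrow> (nat set \<Rightarrow> 'k::field) \<Rightarrow> (nat set \<Rightarrow> 'k)" where
  "boundary K c = (\<lambda>\<tau>. if \<tau> = {} then 0
     else \<Sum>v \<in> \<Union>K - \<tau>. (-1) ^ card {u \<in> \<tau>. u < v} * c (insert v \<tau>))"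

definition cycles :: "nat \<Rightarrow> nat set set \<Rightarrow> (nat set \<Rightarrow> 'k::field) set" where
  "cycles p K = {c \<in> chains p K. boundary K c = 0}"

definition boundaries :: "nat \<Rightarrow> nat set set \<Rightarrow> (nat set \<Rightarrow> 'k::field) set" where
  "boundaries p K = boundary K ` chains (Suc p) K"

text \<open>For finite complexes \<open>K \<subseteq> L\<close>, the persistent homology group is the image of
  \<open>H\<^sub>p(K) \<rightarrow> H\<^sub>p(L)\<close>, that is, the quotient of the cycles of \<open>K\<close> by those cycles of \<open>K\<close> that are
  boundaries in \<open>L\<close>. The persistent Betti number is its dimension.\<close>

definition persistent_betti :: "'k::field itself \<Rightarrow> nat \<Rightarrow> nat set set \<Rightarrow> nat set set \<Rightarrow> nat" where
  "persistent_betti _ p K L =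
     vector_space.dim chain_scale (cycles p K :: (nat set \<Rightarrow> 'k) set)
     - vector_space.dim chain_scale (cycles p K \<inter> boundaries p L :: (nat set \<Rightarrow> 'k) set)"

section \<open>Sublevel-set filtration of the subdivided interval\<close>

definition interval_complex :: "nat \<Rightarrow> nat set set" where
  "interval_complex N = (\<lambda>i. {i}) ` {1..N} \<union> (\<lambda>i. {i, i + 1}) ` {1..<N}"

definition simplex_value :: "(nat \<Rightarrow> real) \<Rightarrow> nat set \<Rightarrow> real" where
  "simplex_value z \<sigma> = Max (z ` \<sigma>)"

definition sublevel :: "nat \<Rightarrow> (nat \<Rightarrow> real) \<Rightarrow> real \<Rightarrow> nat set set" where
  "sublevel N z r = {\<sigma> \<in> interval_complex N. simplex_value z \<sigma> \<le> r}"

definition sorted_value :: "nat \<Rightarrow> (nat \<Rightarrow> real) \<Rightarrow> nat \<Rightarrow> real" where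
  "sorted_value N z i = sort (map z [1..<N + 1]) ! (i - 1)"

definition filtration :: "nat \<Rightarrow> (nat \<Rightarrow> real) \<Rightarrow> nat \<Rightarrow> nat set set" where
  "filtration N z i = (if i = 0 then {} else sublevel N z (sorted_value N z i))"

section \<open>Persistence diagrams of level zero\<close>

definition level_betti :: "'k::field itself \<Rightarrow> nat \<Rightarrow> (nat \<Rightarrow> real) \<Rightarrow> nat \<Rightarrow> nat \<Rightarrow> nat" where
  "level_betti T N z i j = persistent_betti T 0 (filtration N z i) (filtration N z j)"

text \<open>The number of classes born entering step \<open>i\<close> and dying entering step \<open>j\<close>, respectively
  living forever. If two consecutive sorted values agree then the corresponding steps of the
  filtration agree, so no class is born or dies at the later one; hence only pairs with
  birth \<open><\<close> death get nonzero multiplicity.\<close>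

definition pair_mult :: "'k::field itself \<Rightarrow> nat \<Rightarrow> (nat \<Rightarrow> real) \<Rightarrow> nat \<Rightarrow> nat \<Rightarrow> nat" where
  "pair_mult T N z i j =
     (level_betti T N z i (j - 1) - level_betti T N z i j)
     - (level_betti T N z (i - 1) (j - 1) - level_betti T N z (i - 1) j)"

definition essential_mult :: "'k::field itself \<Rightarrow> nat \<Rightarrow> (nat \<Rightarrow> real) \<Rightarrow> nat \<Rightarrow> nat" where
  "essential_mult T N z i = level_betti T N z i N - level_betti T N z (i - 1) N"

type_synonym diagram = "(real \<times> ereal) multiset"

definition Dgm :: "'k::field itself \<Rightarrow> nat \<Rightarrow> (nat \<Rightarrow> real) \<Rightarrow> diagram" where
  "Dgm T N z =
     (\<Sum>i = 1..N. \<Sum>j = i + 1..N.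
        replicate_mset (pair_mult T N z i j)
          (sorted_value N z i, ereal (sorted_value N z j)))
     + (\<Sum>i = 1..N. replicate_mset (essential_mult T N z i) (sorted_value N z i, \<infinity>))"

definition Per :: "diagram set" where
  "Per = {P. \<forall>(b, d) \<in># P. ereal b < d}"

text \<open>Points of \<open>\<real>\<^sup>N\<close> are vectors over a finite index type, whose coordinates are
  numbered \<open>1, \<dots>, N\<close> by \<open>ix\<close>.\<close>

definition data_space :: "'k::field itself \<Rightarrow> (nat \<Rightarrow> 'n::finite) \<Rightarrow> diagram \<Rightarrow> (real ^ 'n) set" where
  "data_space T ix P = {z. Dgm T CARD('n) (\<lambda>j. z $ ix j) = P}"

end

theory Submission
  imports Defs
begin

text \<open>
  Up to a reparametrisation, \<open>z\<close> is determined by its sequence of critical values: there is a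
  continuous function \<open>f\<close> on the line with slopes \<open>\<plusminus>1\<close>, which changes direction exactly at the points
  of a finite set \<open>S\<close> of odd size, and a nondecreasing \<open>t\<close> whose values include \<open>S\<close>, such that
  \<open>z\<^sub>j = f(t\<^sub>j)\<close>. The function \<open>f\<close> is unique up to translation, and \<open>t\<close> is recovered continuously
  from \<open>z\<close> by summing the increments \<open>\<bar>z\<^sub>l\<^sub>+\<^sub>1 - z\<^sub>l\<bar>\<close>. So \<open>\<real>\<^sup>N\<close> is the disjoint union of closed
  strata, each homeomorphic to a space \<open>T(S)\<close> of nondecreasing vectors whose coordinates
  include \<open>S\<close>, which is visibly a finite union of polyhedra.

  The persistent Betti number at \<open>a \<le> b\<close> counts the runs of \<open>{z \<le> b}\<close> that meet \<open>{z \<le> a}\<close>. It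
  depends only on \<open>f\<close>, hence so does the diagram, and every fibre of \<open>Dgm\<close> is a union of strata. Every
  critical value is a coordinate of a point of the diagram, so only finitely many strata have
  diagram \<open>P\<close>; being closed, disjoint and connected, they are the components of the fibre.

  Finally \<open>T(S)\<close> is contractible: clamp all coordinates to the convex hull of \<open>S\<close>. The clamped
  vectors have a least and a greatest element, which are joined by a path \<open>\<gamma>\<close> in \<open>T(S)\<close>; as \<open>T(S)\<close> is
  closed under coordinatewise maxima, \<open>max(t, \<gamma>(s))\<close> contracts it.
\<close>

section \<open>Zigzag functions\<close>

text \<open>The slope is \<open>-1\<close> to the left of \<open>S\<close> and changes sign at every point of \<open>S\<close>.\<close>

definition zigzag :: "real \<Rightarrow> real set \<Rightarrow> real \<Rightarrow> real" where
  "zigzag c S t = c - t + 2 * (\<Sum>p\<in>S. (-1) ^ card {q \<in> S. q < p} * max 0 (t - p))"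

text \<open>The signs alternate along the increasing enumeration, starting with \<open>+1\<close>,
  so they cancel in pairs; a new maximum contributes the sign given by the parity of what lies below
  it.\<close>

lemma alternating_rank_sum:
  fixes A :: "'a::linorder set"
  assumes "finite A"
  shows "(\<Sum>p\<in>A. (-1::real) ^ card {q \<in> A. q < p}) = (if odd (card A) then 1 else 0)"
  using assms
proof (induction A rule: finite_linorder_max_induct)
  case (insert b A)
  have *: "{q \<in> insert b A. q < p} = {q \<in> A. q < p}" if "p \<in> A" for p
    using insert that by auto
  have b: "{q \<in> insert b A. q < b} = A" using insert by auto
  have "(\<Sum>p\<in>insert b A. (-1::real) ^ card {q \<in> insert b A. q < p})
      = (-1) ^ card A + (\<Sum>p\<in>A. (-1) ^ card {q \<in> A. q < p})"
    using insert * b by (subst sum.insert) auto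
  then show ?case using insert by (auto simp: card_insert_if)
qed simp

text \<open>The ramp of a turning point at or left of \<open>a\<close> grows at unit rate on the
  whole interval, and one at or right of \<open>b\<close> stays zero. The signs of the former add up
  to 0 or 1, according to the parity of their number, so the slope is \<open>-1\<close> or
  \<open>-1 + 2\<close>.\<close>

lemma zigzag_gap:
  assumes "finite S" "\<And>p. p \<in> S \<Longrightarrow> p \<le> a \<or> b \<le> p" "x \<in> {a..b}" "y \<in> {a..b}"
  shows "zigzag c S y - zigzag c S x = (-1) ^ Suc (card {p \<in> S. p \<le> a}) * (y - x)"
proof -
  let ?A = "{p \<in> S. p \<le> a}" and ?r = "\<lambda>p. (-1::real) ^ card {q \<in> S. q < p}"
  have rank: "?r p = (-1) ^ card {q \<in> ?A. q < p}" if "p \<in> ?A" for p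
  proof -
    have "{q \<in> S. q < p} = {q \<in> ?A. q < p}" using that by auto
    then show ?thesis by simp
  qed
  have sum: "(\<Sum>p\<in>S. ?r p * (max 0 (y - p) - max 0 (x - p))) = (\<Sum>p\<in>?A. ?r p * (y - x))"
  proof (rule sum.mono_neutral_cong_right)
    show "\<forall>p\<in>S - ?A. ?r p * (max 0 (y - p) - max 0 (x - p)) = 0"
      using assms(2-4) by (auto simp: max_def) (meson order_trans order_antisym)+
    show "?r p * (max 0 (y - p) - max 0 (x - p)) = ?r p * (y - x)" if "p \<in> ?A" for p
      using that assms(3,4) by simp
  qed (use assms(1) in auto)
  have "zigzag c S y - zigzag c S x
      = x - y + 2 * (\<Sum>p\<in>S. ?r p * (max 0 (y - p) - max 0 (x - p)))"
    by (simp add: zigzag_def sum_subtractf right_diff_distrib)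
  also have "\<dots> = x - y + 2 * ((\<Sum>p\<in>?A. ?r p) * (y - x))"
    by (simp only: sum sum_distrib_right)
  also have "(\<Sum>p\<in>?A. ?r p) = (if odd (card ?A) then 1 else 0)"
    using alternating_rank_sum[of ?A] rank assms(1) by simp
  finally show ?thesis by (auto simp: algebra_simps minus_one_power_iff)
qed

lemma zigzag_left:
  assumes "\<And>p. p \<in> S \<Longrightarrow> x \<le> p"
  shows "zigzag c S x = c - x"
  using assms by (simp add: zigzag_def)

text \<open>For odd \<open>card S\<close> the final slope is \<open>+1\<close>. As the initial slope
  is \<open>-1\<close>, the function then increases away from \<open>S\<close> on both sides, which
  is the purpose of the parity condition.\<close>

lemma zigzag_right:
  assumes "finite S" "\<And>p. p \<in> S \<Longrightarrow> p \<le> x" "x \<le> y"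
  shows "zigzag c S y - zigzag c S x = (-1) ^ Suc (card S) * (y - x)"
proof -
  have "{p \<in> S. p \<le> x} = S" using assms by auto
  then show ?thesis using zigzag_gap[of S x y x y c] assms by auto
qed

text \<open>One more ramp, starting beyond all the others, changes nothing up to \<open>m\<close>
  and reverses the direction from there on.\<close>

lemma zigzag_insert:
  assumes "finite S" "\<And>p. p \<in> S \<Longrightarrow> p < m"
  shows "zigzag c (insert m S) x = zigzag c S x + 2 * (-1) ^ card S * max 0 (x - m)"
proof -
  have "m \<notin> S" using assms by auto
  moreover have "{q. (q = m \<or> q \<in> S) \<and> q < m} = S" using assms by auto
  moreover have "{q. (q = m \<or> q \<in> S) \<and> q < p} = {q \<in> S. q < p}" if "p \<in> S" for p
    using assms that by force
  ultimately show ?thesis using assms(1) by (simp add: zigzag_def algebra_simps)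
qed

lemma continuous_on_zigzag [continuous_intros]:
  assumes "continuous_on A g"
  shows "continuous_on A (\<lambda>x. zigzag c S (g x))"
  unfolding zigzag_def by (intro continuous_intros assms)

section \<open>Moving along a zigzag function to turning points\<close>

lemma finite_neighbours:
  fixes x :: "'a::linorder"
  assumes "finite S" "x \<notin> S"
  shows "\<exists>p\<in>S. p < x \<Longrightarrow> \<exists>l\<in>S. l < x \<and> (\<forall>p\<in>S. p \<le> l \<or> x < p)"
    and "\<exists>p\<in>S. x < p \<Longrightarrow> \<exists>u\<in>S. x < u \<and> (\<forall>p\<in>S. p < x \<or> u \<le> p)"
proof -
  assume "\<exists>p\<in>S. p < x"
  then have "Max {p \<in> S. p < x} \<in> {p \<in> S. p < x}"
    using assms(1) by (intro Max_in) auto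
  moreover have "p \<le> Max {p \<in> S. p < x}" if "p \<in> S" "p < x" for p
    using assms(1) that by (intro Max_ge) auto
  ultimately show "\<exists>l\<in>S. l < x \<and> (\<forall>p\<in>S. p \<le> l \<or> x < p)"
    using assms(2) by (intro bexI[of _ "Max {p \<in> S. p < x}"]) (auto, metis linorder_neqE)
next
  assume "\<exists>p\<in>S. x < p"
  then have "Min {p \<in> S. x < p} \<in> {p \<in> S. x < p}"
    using assms(1) by (intro Min_in) auto
  moreover have "Min {p \<in> S. x < p} \<le> p" if "p \<in> S" "x < p" for p
    using assms(1) that by (intro Min_le) auto
  ultimately show "\<exists>u\<in>S. x < u \<and> (\<forall>p\<in>S. p < x \<or> u \<le> p)"
    using assms(2) by (intro bexI[of _ "Min {p \<in> S. x < p}"]) (auto, metis linorder_neqE)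
qed

lemma zigzag_between:
  assumes "finite S" "x \<notin> S" "\<exists>p\<in>S. p < x" "\<exists>p\<in>S. x < p"
  obtains l u g where "l \<in> S" "u \<in> S" "l < x" "x < u" "\<And>p. p \<in> S \<Longrightarrow> p \<le> l \<or> u \<le> p" "g = 1 \<or> g = -1"
    "\<And>y y'. y \<in> {l..u} \<Longrightarrow> y' \<in> {l..u} \<Longrightarrow> zigzag c S y' - zigzag c S y = g * (y' - y)"
proof -
  obtain l where l: "l \<in> S" "l < x" "\<forall>p\<in>S. p \<le> l \<or> x < p"
    using finite_neighbours(1)[OF assms(1-3)] by blast
  obtain u where u: "u \<in> S" "x < u" "\<forall>p\<in>S. p < x \<or> u \<le> p"
    using finite_neighbours(2)[OF assms(1,2,4)] by blast
  have gap: "p \<le> l \<or> u \<le> p" if "p \<in> S" for p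
    using l(3) u(3) that by (meson leD order.asym)
  show thesis
    by (rule that[of l u "(-1) ^ Suc (card {p \<in> S. p \<le> l})"])
      (use l u gap zigzag_gap[OF assms(1) gap] in \<open>auto simp: power_Suc minus_one_power_iff\<close>)
qed

text \<open>One descends from \<open>y\<close> until the direction changes: within a linear piece to
  its lower end, from the left of \<open>S\<close> rightwards, and from the right of
  \<open>S\<close> leftwards, where the odd cardinality makes the slope \<open>+1\<close>.\<close>

lemma zigzag_downhill:
  assumes "finite S" "odd (card S)"
  shows "\<exists>p\<in>S. \<forall>x. min y p \<le> x \<and> x \<le> max y p \<longrightarrow> zigzag c S x \<le> zigzag c S y"
proof -
  have ne: "S \<noteq> {}" using assms by auto
  consider "y \<in> S" | "y \<notin> S" "\<exists>p\<in>S. p < y" "\<exists>p\<in>S. y < p" | "\<forall>p\<in>S. y < p" | "\<forall>p\<in>S. p < y"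
    by (metis linorder_neqE)
  then show ?thesis
  proof cases
    case 1
    then show ?thesis by (intro bexI[of _ y]) auto
  next
    case 2
    from zigzag_between[OF assms(1) this] obtain l u g where
      lu: "l \<in> S" "u \<in> S" "l < y" "y < u" "g = 1 \<or> g = -1"
      and f: "\<And>x x'. x \<in> {l..u} \<Longrightarrow> x' \<in> {l..u} \<Longrightarrow> zigzag c S x' - zigzag c S x = g * (x' - x)"
      by metis
    show ?thesis
    proof (cases "g = 1")
      case True
      have "zigzag c S x \<le> zigzag c S y" if "l \<le> x" "x \<le> y" for x
        using f[of x y] lu that True by auto
      then show ?thesis using lu by (intro bexI[of _ l]) auto
    next
      case False
      have "zigzag c S x \<le> zigzag c S y" if "y \<le> x" "x \<le> u" for x
        using f[of x y] lu that False by auto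
      then show ?thesis using lu by (intro bexI[of _ u]) auto
    qed
  next
    case 3
    have m: "Min S \<in> S" "\<And>p. p \<in> S \<Longrightarrow> Min S \<le> p" using assms ne by auto
    have "zigzag c S x \<le> zigzag c S y" if "y \<le> x" "x \<le> Min S" for x
      using zigzag_left[of S x c] zigzag_left[of S y c] m that by force
    then show ?thesis using m 3 by (intro bexI[of _ "Min S"]) (auto simp: max_def min_def)
  next
    case 4
    have m: "Max S \<in> S" "\<And>p. p \<in> S \<Longrightarrow> p \<le> Max S" using assms ne by auto
    have "zigzag c S x \<le> zigzag c S y" if "Max S \<le> x" "x \<le> y" for x
      using zigzag_right[OF assms(1), of x y c] m(2) that assms(2) by (force simp: minus_one_power_iff)
    then show ?thesis using m 4 by (intro bexI[of _ "Max S"]) (auto simp: max_def min_def)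
  qed
qed

text \<open>The higher end of the linear piece through \<open>x\<close> will do; the piece cannot
  leave the interval from \<open>p\<close> to \<open>p'\<close>, because both are turning points
  themselves.\<close>

lemma zigzag_uphill:
  assumes "finite S" "p \<in> S" "p' \<in> S" "p \<le> x" "x \<le> p'"
  shows "\<exists>q\<in>S. p \<le> q \<and> q \<le> p' \<and> zigzag c S x \<le> zigzag c S q"
proof (cases "x \<in> S")
  case False
  then have "\<exists>p\<in>S. p < x" "\<exists>p\<in>S. x < p"
    using assms by (metis order.order_iff_strict)+
  from zigzag_between[OF assms(1) False this] obtain l u g where
    lu: "l \<in> S" "u \<in> S" "l < x" "x < u" "\<And>p. p \<in> S \<Longrightarrow> p \<le> l \<or> u \<le> p" "g = 1 \<or> g = -1"
    and f: "\<And>x x'. x \<in> {l..u} \<Longrightarrow> x' \<in> {l..u} \<Longrightarrow> zigzag c S x' - zigzag c S x = g * (x' - x)"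
    by metis
  have "p \<le> l" "u \<le> p'" using lu(3,4) lu(5)[OF assms(2)] lu(5)[OF assms(3)] assms(4,5) by auto
  then show ?thesis
    using lu f[of x u] f[of x l] by (cases "g = 1") (auto intro: bexI[of _ u] bexI[of _ l])
qed (use assms in auto)

text \<open>Close to \<open>x\<close> the function is symmetric if the slopes on the two sides are
  opposite, and strictly monotone otherwise. Thus \<open>S\<close> can be recovered from the
  function alone.\<close>

lemma zigzag_turning_iff:
  assumes "finite S"
  shows "x \<in> S \<longleftrightarrow> (\<exists>e>0. \<forall>h. 0 < h \<and> h < e \<longrightarrow> zigzag c S (x + h) = zigzag c S (x - h))"
proof -
  obtain e where e: "e > 0" "\<And>p. p \<in> S \<Longrightarrow> p \<noteq> x \<Longrightarrow> e \<le> dist x p"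
    using finite_set_avoid[OF assms, of x] by metis
  have far: "p \<le> x - h \<or> x + h \<le> p" if "p \<in> S" "p \<noteq> x" "0 < h" "h < e" for p h
    using e(2)[OF that(1,2)] that by (auto simp: dist_real_def abs_if split: if_splits)
  have 1: "zigzag c S (x + h) = zigzag c S (x - h)" if "x \<in> S" "0 < h" "h < e" for h
  proof -
    have "zigzag c S x - zigzag c S (x - h) = (-1) ^ Suc (card {p \<in> S. p \<le> x - h}) * h"
      by (subst zigzag_gap[OF assms, of "x - h" x]) (use far that in force)+
    moreover have "zigzag c S (x + h) - zigzag c S x = (-1) ^ Suc (card {p \<in> S. p \<le> x}) * h"
      by (subst zigzag_gap[OF assms, of x "x + h"]) (use far that in force)+
    moreover have "{p \<in> S. p \<le> x} = insert x {p \<in> S. p \<le> x - h}"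
      using far[OF _ _ that(2,3)] that by force
    ultimately show ?thesis using assms that by (simp add: card_insert_if)
  qed
  have 2: "zigzag c S (x + h) \<noteq> zigzag c S (x - h)" if "x \<notin> S" "0 < h" "h < e" for h
  proof -
    have "zigzag c S (x + h) - zigzag c S (x - h) = (-1) ^ Suc (card {p \<in> S. p \<le> x - h}) * (2 * h)"
      by (subst zigzag_gap[OF assms, of "x - h" "x + h"]) (use far that in force)+
    then show ?thesis using that by (auto simp: minus_one_power_iff split: if_splits)
  qed
  show ?thesis
  proof
    assume "\<exists>e>0. \<forall>h. 0 < h \<and> h < e \<longrightarrow> zigzag c S (x + h) = zigzag c S (x - h)"
    then obtain e' where "e' > 0" "\<And>h. 0 < h \<Longrightarrow> h < e' \<Longrightarrow> zigzag c S (x + h) = zigzag c S (x - h)"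
      by blast
    moreover have "0 < min e e' / 2" "min e e' / 2 < e" "min e e' / 2 < e'"
      using e(1) \<open>e' > 0\<close> by auto
    ultimately show "x \<in> S" using 2 by blast
  qed (use 1 e(1) in blast)
qed

section \<open>Persistent Betti numbers of the path\<close>

text \<open>Each run of \<open>{z \<le> b}\<close> that meets \<open>{z \<le> a}\<close> is represented by its first vertex with value at
  most \<open>a\<close>.\<close>

definition run_starts :: "nat \<Rightarrow> (nat \<Rightarrow> real) \<Rightarrow> real \<Rightarrow> real \<Rightarrow> nat set" where
  "run_starts N z a b =
     {v \<in> {1..N}. z v \<le> a \<and> (\<forall>u\<in>{1..<v}. z u \<le> a \<longrightarrow> (\<exists>x. u < x \<and> x < v \<and> b < z x))}"

text \<open>The representative of the run of \<open>v\<close>. A candidate beyond \<open>v\<close>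
  meets the last condition vacuously, but \<open>v\<close> is itself a candidate when
  \<open>z v \<le> a\<close> and \<open>a \<le> b\<close>, so the least one is at most
  \<open>v\<close>.\<close>

definition run_start :: "(nat \<Rightarrow> real) \<Rightarrow> real \<Rightarrow> real \<Rightarrow> nat \<Rightarrow> nat" where
  "run_start z a b v = (LEAST u. 1 \<le> u \<and> z u \<le> a \<and> (\<forall>x. u \<le> x \<and> x \<le> v \<longrightarrow> z x \<le> b))"

lemma finite_run_starts [simp]: "finite (run_starts N z a b)"
  by (simp add: run_starts_def)

lemma run_startD:
  assumes "a \<le> b" "v \<in> {1..N}" "z v \<le> a"
  shows "run_start z a b v \<in> run_starts N z a b" "run_start z a b v \<le> v"
    "\<And>x. run_start z a b v \<le> x \<Longrightarrow> x \<le> v \<Longrightarrow> z x \<le> b"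
proof -
  let ?Q = "\<lambda>u. 1 \<le> u \<and> z u \<le> a \<and> (\<forall>x. u \<le> x \<and> x \<le> v \<longrightarrow> z x \<le> b)" and ?u = "run_start z a b v"
  have v: "?Q v" using assms by (metis atLeastAtMost_iff order_antisym order_trans)
  show le: "?u \<le> v" unfolding run_start_def by (rule Least_le) (rule v)
  have Q: "?Q ?u" unfolding run_start_def by (rule LeastI) (rule v)
  then show "z x \<le> b" if "?u \<le> x" "x \<le> v" for x using that by blast
  \<comment> \<open>Without a barrier above \<open>b\<close>, the earlier vertex \<open>u\<close>
    would be a smaller candidate.\<close>
  have "\<exists>x. u < x \<and> x < ?u \<and> b < z x" if "u \<in> {1..<?u}" "z u \<le> a" for u
  proof (rule ccontr)
    assume "\<not> ?thesis"
    then have less: "z x \<le> b" if "u < x" "x < ?u" for x using that by force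
    have "z x \<le> b" if "u \<le> x" "x \<le> v" for x
    proof (cases "x = u \<or> ?u \<le> x")
      case True
      then show ?thesis using Q that \<open>z u \<le> a\<close> \<open>a \<le> b\<close> by auto
    qed (use less that in auto)
    then have "?Q u" using that by auto
    then have "?u \<le> u" unfolding run_start_def by (rule Least_le)
    then show False using that by auto
  qed
  then show "?u \<in> run_starts N z a b" using Q le assms(2) by (auto simp: run_starts_def)
qed

text \<open>Two distinct representatives are separated by a value above \<open>b\<close>, which
  would lie between the earlier one and \<open>v\<close>, where all values are at most
  \<open>b\<close>.\<close>

lemma run_start_eqI:
  assumes "u \<in> run_starts N z a b" "u \<le> v" "\<And>x. u \<le> x \<Longrightarrow> x \<le> v \<Longrightarrow> z x \<le> b"
    "a \<le> b" "v \<in> {1..N}" "z v \<le> a"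
  shows "run_start z a b v = u"
proof (rule linorder_cases[of "run_start z a b v" u])
  note d = run_startD[of a b v N z, OF assms(4-6)]
  assume lt: "run_start z a b v < u"
  then obtain x where "run_start z a b v < x" "x < u" "b < z x"
    using assms(1) d(1) by (auto simp: run_starts_def)
  then show ?thesis using d(3)[of x] assms(2) by simp
next
  note d = run_startD[of a b v N z, OF assms(4-6)]
  assume "u < run_start z a b v"
  then obtain x where "u < x" "x < run_start z a b v" "b < z x"
    using assms(1) d(1) by (auto simp: run_starts_def)
  then show ?thesis using d(2) assms(3)[of x] by simp
qed

lemma run_start_self:
  assumes "u \<in> run_starts N z a b" "a \<le> b"
  shows "run_start z a b u = u"
  using assms by (intro run_start_eqI) (auto simp: run_starts_def intro: order_trans)

lemma run_starts_antimono:
  assumes "b \<le> b'"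
  shows "run_starts N z a b' \<subseteq> run_starts N z a b"
proof -
  have "b < r" if "b' < r" for r using assms that by linarith
  then show ?thesis unfolding run_starts_def by blast
qed

section \<open>Chains, cycles and boundaries of degree zero on the path\<close>

lemma sum_apply:
  fixes f :: "'a \<Rightarrow> 'b \<Rightarrow> 'c::comm_monoid_add"
  shows "sum f A x = (\<Sum>a\<in>A. f a x)"
  by (induction A rule: infinite_finite_induct) auto

definition vertex_chain :: "nat \<Rightarrow> nat set \<Rightarrow> 'k::field" where
  "vertex_chain v = (\<lambda>\<sigma>. if \<sigma> = {v} then 1 else 0)"

lemma vertex_in_sublevel: "{v} \<in> sublevel N z a \<longleftrightarrow> v \<in> {1..N} \<and> z v \<le> a"
proof -
  have "{v} \<in> interval_complex N \<longleftrightarrow> v \<in> {1..N}"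
    unfolding interval_complex_def by (auto simp: image_iff)
  then show ?thesis by (simp add: sublevel_def simplex_value_def)
qed

lemma edge_in_sublevel:
  "{i, Suc i} \<in> sublevel N z a \<longleftrightarrow> 1 \<le> i \<and> Suc i \<le> N \<and> z i \<le> a \<and> z (Suc i) \<le> a"
proof -
  have "{i, Suc i} = {j, j + 1} \<longleftrightarrow> i = j" "{i, Suc i} \<noteq> {j}" for j
    by (auto simp: doubleton_eq_iff)
  then have "{i, Suc i} \<in> interval_complex N \<longleftrightarrow> i \<in> {1..<N}"
    by (simp only: interval_complex_def Un_iff image_iff bex_triv_one_point2 bex_simps simp_thms) blast
  then have "{i, Suc i} \<in> interval_complex N \<longleftrightarrow> 1 \<le> i \<and> Suc i \<le> N" by auto
  then show ?thesis by (simp add: sublevel_def simplex_value_def)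
qed

lemma sublevel_cases:
  assumes "\<sigma> \<in> sublevel N z a"
  obtains v where "\<sigma> = {v}" | i where "\<sigma> = {i, Suc i}"
  using assms unfolding sublevel_def interval_complex_def by (auto simp: image_iff)

lemma Union_sublevel: "\<Union> (sublevel N z a) = {v \<in> {1..N}. z v \<le> a}"
proof (rule set_eqI)
  fix v
  have "\<exists>\<sigma>\<in>sublevel N z a. v \<in> \<sigma>" if "v \<in> {1..N}" "z v \<le> a"
    using that vertex_in_sublevel by blast
  moreover have "v \<in> {1..N} \<and> z v \<le> a" if s: "\<sigma> \<in> sublevel N z a" "v \<in> \<sigma>" for \<sigma>
    using s(1) by (cases rule: sublevel_cases) (use s in \<open>auto simp: vertex_in_sublevel edge_in_sublevel\<close>)
  ultimately show "v \<in> \<Union> (sublevel N z a) \<longleftrightarrow> v \<in> {v \<in> {1..N}. z v \<le> a}" by blast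
qed

text \<open>Adding a new vertex to a nonempty \<open>\<tau>\<close> gives at least two vertices,
  where a 0-chain vanishes; at the empty face the boundary is zero by definition.\<close>

lemma boundary_vertices:
  fixes c :: "nat set \<Rightarrow> 'k::field"
  assumes "c \<in> chains 0 K"
  shows "boundary L c = 0"
proof
  fix \<tau>
  have "c (insert v \<tau>) = 0" if "\<tau> \<noteq> {}" "v \<notin> \<tau>" for v
  proof (rule ccontr)
    assume "c (insert v \<tau>) \<noteq> 0"
    then have "card (insert v \<tau>) = 1" using assms by (auto simp: chains_def)
    then show False using that by (auto simp: card_1_singleton_iff)
  qed
  then show "boundary L c \<tau> = 0 \<tau>" by (auto simp: boundary_def intro!: sum.neutral)
qed

lemma cycles_0: "cycles 0 K = chains 0 K"
  by (auto simp: cycles_def boundary_vertices)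

text \<open>Only \<open>j - 1\<close> and \<open>Suc j\<close> can complete \<open>j\<close> to an
  edge. The signs differ because \<open>j\<close> precedes \<open>Suc j\<close> but not
  \<open>j - 1\<close>.\<close>

lemma boundary_edges:
  fixes c :: "nat set \<Rightarrow> 'k::field"
  assumes c: "c \<in> chains (Suc 0) (sublevel N z b)"
  shows "boundary (sublevel N z b) c {j} = c {j - 1, j} - c {j, Suc j}"
    and "card \<tau> \<noteq> 1 \<Longrightarrow> boundary (sublevel N z b) c \<tau> = 0"
proof -
  let ?L = "sublevel N z b"
  have edge: "\<exists>i. \<sigma> = {i, Suc i} \<and> {i, Suc i} \<in> ?L" if "c \<sigma> \<noteq> 0" for \<sigma>
  proof -
    from that have "\<sigma> \<in> ?L" "card \<sigma> = 2" using c by (auto simp: chains_def)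
    show ?thesis
      using \<open>\<sigma> \<in> ?L\<close> by (cases rule: sublevel_cases) (use \<open>\<sigma> \<in> ?L\<close> \<open>card \<sigma> = 2\<close> in \<open>fastforce+\<close>)
  qed
  have zero: "c {v, w} = 0" if "v \<noteq> Suc w \<and> w \<noteq> Suc v \<or> v \<notin> \<Union> ?L" for v w
  proof (rule ccontr)
    assume "c {v, w} \<noteq> 0"
    then obtain i where i: "{v, w} = {i, Suc i}" "{i, Suc i} \<in> ?L" using edge by blast
    have "v \<in> \<Union> ?L" using i(2) unfolding i(1)[symmetric] by blast
    moreover have "v = Suc w \<or> w = Suc v" using i(1) unfolding doubleton_eq_iff by blast
    ultimately show False using that by blast
  qed
  let ?f = "\<lambda>v. (-1) ^ card {u \<in> {j}. u < v} * c (insert v {j})"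
  have "boundary ?L c {j} = (\<Sum>v\<in>\<Union> ?L - {j}. ?f v)"
    by (simp add: boundary_def)
  also have "\<dots> = (\<Sum>v\<in>{j - 1, Suc j} - {j}. ?f v)"
  proof (rule sum.mono_neutral_cong)
    show "?f v = 0" if "v \<in> ({j - 1, Suc j} - {j}) - (\<Union> ?L - {j})" for v
    proof -
      have "c (insert v {j}) = 0" using that zero[of v j] by blast
      then show ?thesis by simp
    qed
    show "?f v = 0" if "v \<in> (\<Union> ?L - {j}) - ({j - 1, Suc j} - {j})" for v
    proof -
      have "v \<noteq> Suc j" "j \<noteq> Suc v" using that by auto
      then have "c (insert v {j}) = 0" using zero[of v j] by blast
      then show ?thesis by simp
    qed
  qed (auto simp: Union_sublevel)
  also have "\<dots> = c {j - 1, j} - c {j, Suc j}"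
  proof (cases j)
    \<comment> \<open>Truncated subtraction turns \<open>{j - 1, j}\<close> into a singleton here;
      both coefficients vanish because \<open>0\<close> is not a vertex.\<close>
    case 0
    have "c {0, 0} = 0" "c {0, Suc 0} = 0"
      using zero[of 0 0] zero[of 0 "Suc 0"] by (simp_all add: Union_sublevel)
    then show ?thesis using 0 by (simp add: insert_commute)
  next
    case (Suc i)
    have e: "{j - 1, Suc j} - {j} = {i, Suc j}" "{u \<in> {j}. u < i} = {}" "{u \<in> {j}. u < Suc j} = {j}"
      using Suc by auto
    have pair: "sum h {i, Suc j} = h i + h (Suc j)" for h :: "nat \<Rightarrow> 'k" using Suc by simp
    have "(\<Sum>v\<in>{j - 1, Suc j} - {j}. ?f v) = c {i, j} - c {j, Suc j}"
      unfolding e(1) pair e(2,3) by (simp add: insert_commute)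
    then show ?thesis using Suc by simp
  qed
  finally show "boundary ?L c {j} = c {j - 1, j} - c {j, Suc j}" .
  show "boundary ?L c \<tau> = 0" if "card \<tau> \<noteq> 1"
  proof -
    have "c (insert v \<tau>) = 0" if "v \<notin> \<tau>" for v
    proof (rule ccontr)
      assume "c (insert v \<tau>) \<noteq> 0"
      then have "card (insert v \<tau>) = 2" using c by (auto simp: chains_def)
      then have "card \<tau> = 1" using that
        by (metis card_insert_if card_gt_0_iff finite_insert nat.inject numeral_2_eq_2 One_nat_def zero_less_numeral)
      then show False using \<open>card \<tau> \<noteq> 1\<close> by simp
    qed
    then show ?thesis by (auto simp: boundary_def intro!: sum.neutral)
  qed
qed

interpretation chain: vector_space "chain_scale :: 'k::field \<Rightarrow> _"
  by (rule vector_space_chain_scale)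

lemma dim_cycles:
  "chain.dim (cycles 0 (sublevel N z a) :: (nat set \<Rightarrow> 'k::field) set) = card {v \<in> {1..N}. z v \<le> a}"
  (is "chain.dim ?Z = card ?A")
proof (rule chain.dim_unique)
  let ?e = "vertex_chain :: nat \<Rightarrow> nat set \<Rightarrow> 'k"
  have inj: "inj_on ?e ?A"
    by (auto simp: inj_on_def vertex_chain_def fun_eq_iff split: if_splits)
  then show "card (?e ` ?A) = card ?A" by (rule card_image)
  show "?e ` ?A \<subseteq> ?Z"
    by (auto simp: cycles_0 chains_def vertex_chain_def vertex_in_sublevel split: if_splits)
  show "?Z \<subseteq> chain.span (?e ` ?A)"
  proof
    fix c :: "nat set \<Rightarrow> 'k" assume "c \<in> ?Z"
    then have c: "\<exists>v\<in>?A. \<sigma> = {v}" if "c \<sigma> \<noteq> 0" for \<sigma>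
      using that by (fastforce simp: cycles_0 chains_def card_1_singleton_iff vertex_in_sublevel)
    have "c = (\<Sum>v\<in>?A. chain_scale (c {v}) (?e v))"
    proof
      fix \<sigma>
      have "(\<Sum>v\<in>?A. chain_scale (c {v}) (?e v)) \<sigma> = (\<Sum>v\<in>?A. if \<sigma> = {v} then c {v} else 0)"
        by (subst sum_apply) (auto simp: chain_scale_def vertex_chain_def intro!: sum.cong)
      also have "\<dots> = c \<sigma>"
      proof (cases "\<exists>v\<in>?A. \<sigma> = {v}")
        case True
        then obtain v where "v \<in> ?A" "\<sigma> = {v}" by blast
        then show ?thesis by (simp add: eq_commute[of v])
      qed (use c in \<open>auto intro!: sum.neutral\<close>)
      finally show "c \<sigma> = (\<Sum>v\<in>?A. chain_scale (c {v}) (?e v)) \<sigma>" by simp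
    qed
    also have "\<dots> \<in> chain.span (?e ` ?A)"
      by (intro chain.span_sum chain.span_scale chain.span_base) auto
    finally show "c \<in> chain.span (?e ` ?A)" .
  qed
  show "chain.independent (?e ` ?A)"
  proof (rule chain.independent_if_scalars_zero)
    fix f x assume "(\<Sum>x\<in>?e ` ?A. chain_scale (f x) x) = 0" "x \<in> ?e ` ?A"
    then obtain v where v: "v \<in> ?A" "x = ?e v" and s: "(\<Sum>v\<in>?A. chain_scale (f (?e v)) (?e v)) = 0"
      using inj by (auto simp: sum.reindex)
    have "0 = (\<Sum>w\<in>?A. chain_scale (f (?e w)) (?e w)) {v}" using s by simp
    also have "\<dots> = (\<Sum>w\<in>?A. if w = v then f (?e v) else 0)"
    proof (unfold sum_apply, rule sum.cong)
      fix w
      show "chain_scale (f (?e w)) (?e w) {v} = (if w = v then f (?e v) else 0)"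
        by (cases "w = v") (auto simp: chain_scale_def vertex_chain_def)
    qed simp
    also have "\<dots> = f x" using v by simp
    finally show "f x = 0" by simp
  qed simp
qed


text \<open>Over the maximal run of \<open>{z \<le> b}\<close> around \<open>u\<close> the boundary
  telescopes to the two edges leaving the run, which are not in the complex. Vertices of the run
  above level \<open>a\<close> contribute nothing, since the boundary is supported on
  \<open>{z \<le> a}\<close>.\<close>

lemma run_boundary_sum:
  fixes g :: "nat set \<Rightarrow> 'k::field"
  assumes "a \<le> b" and u: "u \<in> run_starts N z a b"
    and g: "g \<in> chains (Suc 0) (sublevel N z b)"
    and c: "boundary (sublevel N z b) g \<in> chains 0 (sublevel N z a)"
  shows "(\<Sum>v\<in>{v \<in> {1..N}. z v \<le> a \<and> run_start z a b v = u}. boundary (sublevel N z b) g {v}) = 0"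
proof -
  let ?c = "boundary (sublevel N z b) g"
  have u1: "1 \<le> u" "u \<le> N" "z u \<le> a" using u by (auto simp: run_starts_def)
  \<comment> \<open>The ends \<open>l\<close> and \<open>r\<close> of the maximal run.\<close>
  define l where "l = (LEAST l. 1 \<le> l \<and> (\<forall>x. l \<le> x \<and> x \<le> u \<longrightarrow> z x \<le> b))"
  define r where "r = (GREATEST r. r \<le> N \<and> (\<forall>x. u \<le> x \<and> x \<le> r \<longrightarrow> z x \<le> b))"
  have base: "z x \<le> b" if "u \<le> x" "x \<le> u" for x
    using that u1 \<open>a \<le> b\<close> by (metis order_antisym order_trans)
  have l: "1 \<le> l" "l \<le> u" "\<And>x. l \<le> x \<Longrightarrow> x \<le> u \<Longrightarrow> z x \<le> b"
  proof -
    have P: "1 \<le> u \<and> (\<forall>x. u \<le> x \<and> x \<le> u \<longrightarrow> z x \<le> b)" using u1 base by blast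
    show "l \<le> u" unfolding l_def by (rule Least_le) (rule P)
    have "1 \<le> l \<and> (\<forall>x. l \<le> x \<and> x \<le> u \<longrightarrow> z x \<le> b)"
      unfolding l_def by (rule LeastI) (rule P)
    then show "1 \<le> l" "\<And>x. l \<le> x \<Longrightarrow> x \<le> u \<Longrightarrow> z x \<le> b" by blast+
  qed
  have lmin: "b < z (l - 1)" if "1 \<le> l - 1"
  proof (rule ccontr)
    assume "\<not> b < z (l - 1)"
    then have "z x \<le> b" if "l - 1 \<le> x" "x \<le> u" for x
      using l(3)[of x] that by (cases "x = l - 1") auto
    then have "1 \<le> l - 1 \<and> (\<forall>x. l - 1 \<le> x \<and> x \<le> u \<longrightarrow> z x \<le> b)" using that by blast
    moreover have "l \<le> m" if "1 \<le> m \<and> (\<forall>x. m \<le> x \<and> x \<le> u \<longrightarrow> z x \<le> b)" for m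
      unfolding l_def by (rule Least_le) (rule that)
    ultimately have "l \<le> l - 1" by blast
    then show False using l(1) by simp
  qed
  let ?R = "\<lambda>r. r \<le> N \<and> (\<forall>x. u \<le> x \<and> x \<le> r \<longrightarrow> z x \<le> b)"
  have Ru: "?R u" using u1 base by blast
  have r: "u \<le> r" "?R r"
    unfolding r_def using Greatest_le_nat[of ?R u N] GreatestI_nat[of ?R u N] Ru by blast+
  have rmax: "v \<le> r" if "?R v" for v
    unfolding r_def using Greatest_le_nat[of ?R v N] that by blast
  have rmax': "Suc r \<le> N \<Longrightarrow> b < z (Suc r)"
    using rmax[of "Suc r"] r(2) by (metis Suc_n_not_le_n le_SucE not_le)
  have supp: "v \<in> {1..N} \<and> z v \<le> a" if "?c {v} \<noteq> 0" for v
    using that c vertex_in_sublevel by (auto simp: chains_def)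
  have "(\<Sum>v\<in>{v \<in> {1..N}. z v \<le> a \<and> run_start z a b v = u}. ?c {v}) = (\<Sum>v\<in>{l..r}. ?c {v})"
  proof (rule sum.mono_neutral_left)
    show "{v \<in> {1..N}. z v \<le> a \<and> run_start z a b v = u} \<subseteq> {l..r}"
    proof
      fix v assume "v \<in> {v \<in> {1..N}. z v \<le> a \<and> run_start z a b v = u}"
      then have v: "v \<in> {1..N}" "z v \<le> a" "run_start z a b v = u" by auto
      note d = run_startD[of a b v N z, OF \<open>a \<le> b\<close> v(1,2), unfolded v(3)]
      have "?R v" using v(1) d(3) by simp
      then show "v \<in> {l..r}" using rmax l(2) d(2) by simp
    qed
    show "\<forall>v\<in>{l..r} - {v \<in> {1..N}. z v \<le> a \<and> run_start z a b v = u}. ?c {v} = 0"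
    proof (intro ballI, rule ccontr)
      fix v assume v: "v \<in> {l..r} - {v \<in> {1..N}. z v \<le> a \<and> run_start z a b v = u}" and "?c {v} \<noteq> 0"
      then have v1: "v \<in> {1..N}" "z v \<le> a" "run_start z a b v \<noteq> u" using supp by auto
      show False
      proof (cases "v < u")
        case True
        then obtain x where "v < x" "x < u" "b < z x" using u v1 by (auto simp: run_starts_def)
        then show False using l(3)[of x] v by auto
      next
        case False
        then have "run_start z a b v = u"
          by (intro run_start_eqI[OF u]) (use r(2) v v1 \<open>a \<le> b\<close> in auto)
        then show False using v1 by simp
      qed
    qed
  qed simp
  also have "\<dots> = (\<Sum>v\<in>{l..r}. g {v - 1, v} - g {v, Suc v})"
    by (simp only: boundary_edges(1)[OF g])
  also have "\<dots> = g {l - 1, l} - g {r, Suc r}"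
  proof -
    have "l \<le> r" using l(2) r(1) by simp
    then show ?thesis by (induction r rule: dec_induct) (simp_all add: atLeastAtMostSuc_conv)
  qed
  \<comment> \<open>For \<open>l = 1\<close> the edge would start at the non-vertex
    \<open>0\<close>; otherwise \<open>z (l - 1)\<close> exceeds \<open>b\<close> by maximality of
    the run.\<close>
  also have "g {l - 1, l} = 0"
  proof (rule ccontr)
    assume "g {l - 1, l} \<noteq> 0"
    then have "{l - 1, Suc (l - 1)} \<in> sublevel N z b" using g l(1) by (auto simp: chains_def)
    then show False using lmin unfolding edge_in_sublevel by auto
  qed
  also have "g {r, Suc r} = 0"
  proof (rule ccontr)
    assume "g {r, Suc r} \<noteq> 0"
    then have "{r, Suc r} \<in> sublevel N z b" using g by (auto simp: chains_def)
    then show False using rmax' unfolding edge_in_sublevel by auto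
  qed
  finally show ?thesis by simp
qed

text \<open>All edges between the representative and \<open>v\<close> lie in the complex at level
  \<open>b\<close>, and the boundary of their sum is the last vertex minus the first.\<close>

lemma run_start_chain_bounds:
  assumes "a \<le> b" "v \<in> {1..N}" "z v \<le> a"
  shows "(vertex_chain v - vertex_chain (run_start z a b v) :: nat set \<Rightarrow> 'k::field)
    \<in> boundaries 0 (sublevel N z b)"
proof -
  let ?L = "sublevel N z b" and ?u = "run_start z a b v"
  note d = run_startD[of a b v N z, OF assms]
  have u: "1 \<le> ?u" using d(1) by (simp add: run_starts_def)
  define g :: "nat set \<Rightarrow> 'k" where "g = (\<lambda>\<sigma>. if \<exists>i. ?u \<le> i \<and> i < v \<and> \<sigma> = {i, Suc i} then 1 else 0)"
  have g: "g \<in> chains (Suc 0) ?L"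
  proof -
    have "\<sigma> \<in> ?L \<and> card \<sigma> = Suc (Suc 0)" if "g \<sigma> \<noteq> 0" for \<sigma>
    proof -
      obtain i where i: "?u \<le> i" "i < v" "\<sigma> = {i, Suc i}"
        using \<open>g \<sigma> \<noteq> 0\<close> unfolding g_def by (auto split: if_splits)
      then show ?thesis using u assms(2) d(3)[of i] d(3)[of "Suc i"] by (simp add: edge_in_sublevel)
    qed
    then show ?thesis unfolding chains_def by blast
  qed
  have g_edge: "g {j, Suc j} = (if ?u \<le> j \<and> j < v then 1 else 0)" for j
    by (auto simp: g_def doubleton_eq_iff)
  have "boundary ?L g \<sigma> = (vertex_chain v - vertex_chain ?u) \<sigma>" for \<sigma>
  proof (cases "card \<sigma> = 1")
    case True
    then obtain j where j: "\<sigma> = {j}" by (auto simp: card_1_singleton_iff)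
    have "g {j - 1, j} = (if ?u < j \<and> j \<le> v then 1 else 0)"
      using g_edge[of "j - 1"] u by (cases j) (auto simp: g_def)
    then show ?thesis using d(2) unfolding j boundary_edges(1)[OF g] g_edge
      by (auto simp: vertex_chain_def)
  next
    case False
    then have "\<sigma> \<noteq> {v}" "\<sigma> \<noteq> {?u}" by auto
    then show ?thesis using boundary_edges(2)[OF g False] by (simp add: vertex_chain_def)
  qed
  then have "vertex_chain v - vertex_chain ?u = boundary ?L g" by (intro ext) simp
  then show ?thesis unfolding boundaries_def using g by blast
qed

text \<open>A cycle at level \<open>a\<close> bounds at level \<open>b\<close> exactly when its
  coefficients sum to zero over every run. A basis of these cycles consists of the differences
  between a vertex that is not a representative and the representative of its run.\<close>

lemma dim_relative_boundaries:
  assumes "a \<le> b"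
  shows "chain.dim (cycles 0 (sublevel N z a) \<inter> boundaries 0 (sublevel N z b) :: (nat set \<Rightarrow> 'k::field) set)
     = card ({v \<in> {1..N}. z v \<le> a} - run_starts N z a b)"
  (is "chain.dim ?Z = card (?A - ?B)")
proof (rule chain.dim_unique)
  let ?e = "vertex_chain :: nat \<Rightarrow> nat set \<Rightarrow> 'k"
  let ?r = "run_start z a b"
  let ?d = "\<lambda>v. ?e v - ?e (?r v)"
  have B: "?B \<subseteq> ?A" by (auto simp: run_starts_def)
  have rB: "?r v \<in> ?B" if "v \<in> ?A" for v using run_startD(1)[of a b v N z] assms that by auto
  \<comment> \<open>Representatives lie in \<open>?B\<close>, so the coefficient at \<open>v\<close>
    sees only \<open>?d v\<close>. Injectivity and independence both rest on this.\<close>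
  have dval: "?d w {v} = (if w = v then 1 else 0)" if "v \<in> ?A - ?B" "w \<in> ?A" for v w
    using that rB[of w] by (auto simp: vertex_chain_def)
  have inj: "inj_on ?d (?A - ?B)"
  proof (rule inj_onI)
    fix v w assume "v \<in> ?A - ?B" "w \<in> ?A - ?B" "?d v = ?d w"
    then show "v = w" using dval[of v v] dval[of v w] by (metis DiffD1 zero_neq_one)
  qed
  then show "card (?d ` (?A - ?B)) = card (?A - ?B)" by (rule card_image)
  show "?d ` (?A - ?B) \<subseteq> ?Z"
  proof (rule image_subsetI)
    fix v assume v: "v \<in> ?A - ?B"
    have "\<sigma> \<in> sublevel N z a \<and> card \<sigma> = Suc 0" if "?d v \<sigma> \<noteq> 0" for \<sigma>
    proof -
      have "\<sigma> = {v} \<or> \<sigma> = {?r v}" using that by (auto simp: vertex_chain_def split: if_splits)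
      then show ?thesis using v rB[of v] B by (auto simp: vertex_in_sublevel)
    qed
    then have "?d v \<in> cycles 0 (sublevel N z a)" unfolding cycles_0 chains_def by blast
    then show "?d v \<in> ?Z" using run_start_chain_bounds[of a b v N z] assms v by blast
  qed
  show "?Z \<subseteq> chain.span (?d ` (?A - ?B))"
  proof
    fix c :: "nat set \<Rightarrow> 'k" assume c: "c \<in> ?Z"
    then have supp: "\<exists>v\<in>?A. \<sigma> = {v}" if "c \<sigma> \<noteq> 0" for \<sigma>
      using that by (fastforce simp: cycles_0 chains_def card_1_singleton_iff vertex_in_sublevel)
    obtain g where g: "g \<in> chains (Suc 0) (sublevel N z b)" "c = boundary (sublevel N z b) g"
      using c by (auto simp: boundaries_def)
    have run_sum: "(\<Sum>v\<in>{v \<in> ?A. ?r v = u}. c {v}) = 0" if "u \<in> ?B" for u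
      using run_boundary_sum[OF assms that g(1)] c unfolding g(2) cycles_0 by (simp add: conj_assoc)
    have "c = (\<Sum>v\<in>?A - ?B. chain_scale (c {v}) (?d v))"
    proof
      fix \<sigma>
      have "(\<Sum>v\<in>?A - ?B. chain_scale (c {v}) (?d v)) \<sigma> = (\<Sum>v\<in>?A - ?B. c {v} * ?d v \<sigma>)"
        by (subst sum_apply) (auto simp: chain_scale_def)
      \<comment> \<open>Representatives may be added to the sum because \<open>?d\<close> vanishes
        on them.\<close>
      also have "\<dots> = (\<Sum>v\<in>?A. c {v} * ?d v \<sigma>)"
      proof (rule sum.mono_neutral_left)
        show "\<forall>v\<in>?A - (?A - ?B). c {v} * ?d v \<sigma> = 0"
          using run_start_self[of _ N z a b] assms by auto
      qed auto
      also have "\<dots> = (\<Sum>v\<in>?A. c {v} * ?e v \<sigma>) - (\<Sum>v\<in>?A. c {v} * ?e (?r v) \<sigma>)"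
        by (simp add: algebra_simps sum_subtractf)
      \<comment> \<open>Grouped by runs, this sum has the run sums of \<open>c\<close> as
        coefficients, and these vanish by \<open>run_sum\<close>.\<close>
      also have "(\<Sum>v\<in>?A. c {v} * ?e (?r v) \<sigma>) = (\<Sum>u\<in>?B. \<Sum>v\<in>{v \<in> ?A. ?r v = u}. c {v} * ?e (?r v) \<sigma>)"
        by (rule sum.group[symmetric]) (use rB in auto)
      also have "\<dots> = (\<Sum>u\<in>?B. (\<Sum>v\<in>{v \<in> ?A. ?r v = u}. c {v}) * ?e u \<sigma>)"
        by (intro sum.cong refl) (simp add: sum_distrib_right)
      also have "\<dots> = 0" using run_sum by simp
      also have "(\<Sum>v\<in>?A. c {v} * ?e v \<sigma>) = c \<sigma>"
      proof (cases "\<exists>v\<in>?A. \<sigma> = {v}")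
        case True
        then obtain w where w: "w \<in> ?A" "\<sigma> = {w}" by blast
        then have "(\<Sum>v\<in>?A. c {v} * ?e v \<sigma>) = (\<Sum>v\<in>?A. if w = v then c {w} else 0)"
          by (intro sum.cong) (auto simp: vertex_chain_def)
        then show ?thesis using w by simp
      next
        case False
        then have "c \<sigma> = 0" "\<forall>v\<in>?A. ?e v \<sigma> = 0" using supp by (auto simp: vertex_chain_def)
        then show ?thesis by simp
      qed
      finally show "c \<sigma> = (\<Sum>v\<in>?A - ?B. chain_scale (c {v}) (?d v)) \<sigma>" unfolding diff_0_right by (rule sym)
    qed
    also have "\<dots> \<in> chain.span (?d ` (?A - ?B))"
      by (intro chain.span_sum chain.span_scale chain.span_base) auto
    finally show "c \<in> chain.span (?d ` (?A - ?B))" .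
  qed
  show "chain.independent (?d ` (?A - ?B))"
  proof (rule chain.independent_if_scalars_zero)
    fix f x assume "(\<Sum>x\<in>?d ` (?A - ?B). chain_scale (f x) x) = 0" "x \<in> ?d ` (?A - ?B)"
    then obtain v where v: "v \<in> ?A - ?B" "x = ?d v"
      and s: "(\<Sum>v\<in>?A - ?B. chain_scale (f (?d v)) (?d v)) = 0"
      using inj by (auto simp: sum.reindex)
    have "0 = (\<Sum>w\<in>?A - ?B. chain_scale (f (?d w)) (?d w)) {v}" using s by simp
    also have "\<dots> = (\<Sum>w\<in>?A - ?B. f (?d w) * ?d w {v})"
      by (subst sum_apply) (simp add: chain_scale_def)
    also have "\<dots> = (\<Sum>w\<in>?A - ?B. if w = v then f (?d v) else 0)"
    proof (rule sum.cong)
      fix w assume "w \<in> ?A - ?B"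
      then show "f (?d w) * ?d w {v} = (if w = v then f (?d v) else 0)"
        using dval[OF v(1), of w] by (cases "w = v") simp_all
    qed simp
    also have "\<dots> = f x" using v by simp
    finally show "f x = 0" by simp
  qed simp
qed

proposition persistent_betti_sublevel:
  assumes "a \<le> b"
  shows "persistent_betti TYPE('k::field) 0 (sublevel N z a) (sublevel N z b)
    = card (run_starts N z a b)"
proof -
  have "run_starts N z a b \<subseteq> {v \<in> {1..N}. z v \<le> a}" by (auto simp: run_starts_def)
  then show ?thesis
    unfolding persistent_betti_def dim_cycles dim_relative_boundaries[OF assms]
    by (subst card_Diff_subset) (auto intro!: diff_diff_cancel card_mono)
qed

section \<open>Invariance of the Betti numbers\<close>

definition adapted :: "nat \<Rightarrow> real set \<Rightarrow> (nat \<Rightarrow> real) \<Rightarrow> bool" where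
  "adapted N S t \<longleftrightarrow> mono_on {1..N} t \<and> S \<subseteq> t ` {1..N}"

lemma adaptedD:
  assumes "adapted N S t"
  shows "i \<in> {1..N} \<Longrightarrow> j \<in> {1..N} \<Longrightarrow> i \<le> j \<Longrightarrow> t i \<le> t j"
    and "p \<in> S \<Longrightarrow> \<exists>j\<in>{1..N}. t j = p"
  using assms unfolding adapted_def mono_on_def by blast+

text \<open>A run of \<open>z\<close> is carried to \<open>z'\<close> by descending from its
  representative to a turning point, which \<open>t'\<close> also attains. Two runs of
  \<open>z\<close> are separated by a value above \<open>b\<close>; climbing from there to a turning
  point gives a separating value that \<open>t'\<close> attains too. So runs are mapped
  injectively.\<close>

lemma card_run_starts_le_adapted:
  assumes S: "finite S" "odd (card S)" and t: "adapted N S t" "adapted N S t'" and "a \<le> b"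
    and z: "\<And>j. j \<in> {1..N} \<Longrightarrow> z j = zigzag c S (t j)"
      "\<And>j. j \<in> {1..N} \<Longrightarrow> z' j = zigzag c S (t' j)"
  shows "card (run_starts N z a b) \<le> card (run_starts N z' a b)"
proof -
  let ?f = "zigzag c S" and ?A = "run_starts N z a b"
  obtain p where p: "\<And>y. p y \<in> S"
      "\<And>y x. min y (p y) \<le> x \<Longrightarrow> x \<le> max y (p y) \<Longrightarrow> ?f x \<le> ?f y"
    using zigzag_downhill[OF S, of _ c] by metis
  have fp: "?f (p y) \<le> ?f y" for y using p(2)[of y "p y"] by simp
  have "\<forall>q\<in>S. \<exists>j\<in>{1..N}. t' j = q" using adaptedD(2)[OF t(2)] by blast
  then obtain h where h: "\<And>q. q \<in> S \<Longrightarrow> h q \<in> {1..N}" "\<And>q. q \<in> S \<Longrightarrow> t' (h q) = q" by metis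
  have h_less: "h q < h q'" if "q \<in> S" "q' \<in> S" "q < q'" for q q'
  proof (rule ccontr)
    assume "\<not> h q < h q'"
    then have "t' (h q') \<le> t' (h q)"
      using adaptedD(1)[OF t(2) h(1)[OF that(2)] h(1)[OF that(1)]] by simp
    then show False using h(2) that by simp
  qed
  define \<rho> where "\<rho> v = h (p (t v))" for v
  have v: "v \<in> {1..N}" "?f (t v) \<le> a" if "v \<in> ?A" for v using that z(1) by (auto simp: run_starts_def)
  have \<rho>: "\<rho> v \<in> {1..N}" "z' (\<rho> v) \<le> a" if "v \<in> ?A" for v
  proof -
    show "\<rho> v \<in> {1..N}" unfolding \<rho>_def by (intro h p)
    then have "z' (\<rho> v) = ?f (p (t v))" using z(2) h(2) p(1) by (simp add: \<rho>_def)
    then show "z' (\<rho> v) \<le> a" using v(2)[OF that] fp[of "t v"] by simp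
  qed
  have False if vw: "v \<in> ?A" "w \<in> ?A" "v < w" "run_start z' a b (\<rho> v) = run_start z' a b (\<rho> w)" for v w
  proof -
    obtain x where x: "v < x" "x < w" "b < z x" using vw by (auto simp: run_starts_def)
    then have xN: "x \<in> {1..N}" using v(1)[OF vw(1)] v(1)[OF vw(2)] by auto
    have tx: "t v \<le> t x" "t x \<le> t w"
      using x adaptedD(1)[OF t(1) v(1)[OF vw(1)] xN] adaptedD(1)[OF t(1) xN v(1)[OF vw(2)]] by simp_all
    have fx: "b < ?f (t x)" using x z(1)[OF xN] by simp
    \<comment> \<open>The descent from \<open>t v\<close> never rises above \<open>a\<close>, hence
      cannot pass the barrier at \<open>t x\<close>; likewise for \<open>t w\<close> below.\<close>
    have 1: "p (t v) \<le> t x"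
    proof (rule ccontr)
      assume "\<not> p (t v) \<le> t x"
      then have "?f (t x) \<le> ?f (t v)" using tx by (intro p(2)) auto
      then show False using fx v(2)[OF vw(1)] \<open>a \<le> b\<close> by linarith
    qed
    have 2: "t x \<le> p (t w)"
    proof (rule ccontr)
      assume "\<not> t x \<le> p (t w)"
      then have "?f (t x) \<le> ?f (t w)" using tx by (intro p(2)) auto
      then show False using fx v(2)[OF vw(2)] \<open>a \<le> b\<close> by linarith
    qed
    \<comment> \<open>The barrier at \<open>t x\<close> need not be visited by \<open>t'\<close>, so
      it is replaced by one at a turning point.\<close>
    obtain q where q: "q \<in> S" "p (t v) \<le> q" "q \<le> p (t w)" "?f (t x) \<le> ?f q"
      using zigzag_uphill[OF S(1) p(1) p(1) 1 2] by blast
    have "q \<noteq> p (t v)" "q \<noteq> p (t w)"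
      using q(4) fx fp[of "t v"] fp[of "t w"] v(2)[OF vw(1)] v(2)[OF vw(2)] \<open>a \<le> b\<close> by auto
    then have "\<rho> v < h q" "h q < \<rho> w" unfolding \<rho>_def using q p(1) by (auto intro!: h_less)
    moreover have "b < z' (h q)" using z(2) h q fx by simp
    ultimately show False
      using run_startD(2)[of a b "\<rho> v" N z', OF \<open>a \<le> b\<close> \<rho>[OF vw(1)]]
        run_startD(3)[of a b "\<rho> w" N z' "h q", OF \<open>a \<le> b\<close> \<rho>[OF vw(2)]] vw(4) by simp
  qed
  then have "inj_on (\<lambda>v. run_start z' a b (\<rho> v)) ?A"
    by (intro inj_onI) (metis linorder_neqE_nat)
  then show ?thesis
    by (rule card_inj_on_le) (use run_startD(1)[of a b _ N z'] \<rho> \<open>a \<le> b\<close> in auto)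
qed

text \<open>The runs counted at level \<open>a'\<close> inject into those at level \<open>a\<close>.
  The run of \<open>k\<close> is missed: every vertex to its right with value at most
  \<open>a'\<close> is cut off from \<open>k\<close> by a value above \<open>b\<close>.\<close>

lemma card_run_starts_less_birth:
  assumes k: "k \<in> run_starts N z a b" and "a' \<le> a" "a \<le> b"
    and esc: "\<And>v. k \<le> v \<Longrightarrow> v \<le> N \<Longrightarrow> z v \<le> a' \<Longrightarrow> \<exists>w\<in>{k..v}. b < z w"
  shows "card (run_starts N z a' b) < card (run_starts N z a b)"
proof -
  let ?A = "run_starts N z a' b"
  have v: "v \<in> {1..N}" "z v \<le> a" if "v \<in> ?A" for v
    using that \<open>a' \<le> a\<close> by (auto simp: run_starts_def)
  note d = run_startD[of a b _ N z, OF \<open>a \<le> b\<close> v]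
  have False if vw: "v \<in> ?A" "w \<in> ?A" "v < w" "run_start z a b v = run_start z a b w" for v w
  proof -
    obtain x where x: "v < x" "x < w" "b < z x" using vw by (auto simp: run_starts_def)
    then show False using d(2)[OF vw(1) vw(1)] d(3)[OF vw(2) vw(2), of x] vw(4) by simp
  qed
  then have inj: "inj_on (run_start z a b) ?A"
    by (intro inj_onI) (metis linorder_neqE_nat)
  have "run_start z a b v \<noteq> k" if "v \<in> ?A" for v
  proof
    assume "run_start z a b v = k"
    then have "k \<le> v" "\<And>x. k \<le> x \<Longrightarrow> x \<le> v \<Longrightarrow> z x \<le> b" using d(2,3)[OF that that] by auto
    moreover have "z v \<le> a'" "v \<le> N" using that by (auto simp: run_starts_def)
    ultimately show False using esc by fastforce
  qed
  then have "run_start z a b ` ?A \<subseteq> run_starts N z a b - {k}" using d(1) by auto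
  then have "card ?A \<le> card (run_starts N z a b - {k})"
    using inj by (intro card_inj_on_le) auto
  also have "\<dots> < card (run_starts N z a b)" using k by (intro card_Diff1_less) auto
  finally show ?thesis .
qed

text \<open>The vertex \<open>k\<close> is a peak with low neighbours. Below its height
  \<open>k + 1\<close> starts a run of its own; at its height that vertex joins the run of
  \<open>k - 1\<close>.\<close>

lemma card_run_starts_less_death:
  assumes "1 < k" "k < N" "z (k - 1) \<le> a" "z (k + 1) \<le> a" "a \<le> b" "b < b'" "z k = b'"
  shows "card (run_starts N z a b') < card (run_starts N z a b)"
proof (rule psubset_card_mono)
  have "k + 1 \<in> run_starts N z a b"
  proof -
    have "\<exists>x. u < x \<and> x < k + 1 \<and> b < z x" if "u \<in> {1..<k + 1}" "z u \<le> a" for u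
      using assms that by (intro exI[of _ k]) (cases "u = k", auto)
    then show ?thesis using assms by (auto simp: run_starts_def)
  qed
  moreover have "k + 1 \<notin> run_starts N z a b'"
  proof
    assume "k + 1 \<in> run_starts N z a b'"
    moreover have "k - 1 \<in> {1..<k + 1}" using assms by auto
    ultimately obtain x where "k - 1 < x" "x < k + 1" "b' < z x"
      using assms(3) unfolding run_starts_def by blast
    moreover from this have "x = k" by simp
    ultimately show False using assms by simp
  qed
  ultimately show "run_starts N z a b' \<subset> run_starts N z a b"
    using run_starts_antimono[of b b' N z a] assms by auto
qed simp

section \<open>Sublevel complexes and the steps of the filtration\<close>

lemma run_starts_cong:
  assumes "\<And>v. v \<in> {1..N} \<Longrightarrow> z v \<le> a \<longleftrightarrow> z v \<le> a'" "\<And>v. v \<in> {1..N} \<Longrightarrow> z v \<le> b \<longleftrightarrow> z v \<le> b'"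
  shows "run_starts N z a b = run_starts N z a' b'"
proof -
  have *: "(\<exists>x. u < x \<and> x < v \<and> b < z x) \<longleftrightarrow> (\<exists>x. u < x \<and> x < v \<and> b' < z x)"
    if "v \<in> {1..N}" for u v
  proof -
    have "b < z x \<longleftrightarrow> b' < z x" if "u < x" "x < v" for x
      using assms(2)[of x] that \<open>v \<in> {1..N}\<close> by (auto simp: not_le[symmetric])
    then show ?thesis by blast
  qed
  have "(\<forall>u\<in>{1..<v}. z u \<le> a \<longrightarrow> (\<exists>x. u < x \<and> x < v \<and> b < z x)) \<longleftrightarrow>
      (\<forall>u\<in>{1..<v}. z u \<le> a' \<longrightarrow> (\<exists>x. u < x \<and> x < v \<and> b' < z x))" if "v \<in> {1..N}" for v
    using *[OF that] assms(1) that by (intro ball_cong refl) auto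
  then show ?thesis unfolding run_starts_def using assms(1) by blast
qed

lemma simplex_value_in_range:
  assumes "\<sigma> \<in> interval_complex N"
  shows "\<exists>v\<in>{1..N}. simplex_value z \<sigma> = z v"
proof -
  from assms have "\<sigma> \<in> sublevel N z (simplex_value z \<sigma>)" by (simp add: sublevel_def)
  then show ?thesis
  proof (cases rule: sublevel_cases)
    case (1 v)
    then show ?thesis using \<open>\<sigma> \<in> sublevel N z _\<close> vertex_in_sublevel
      by (intro bexI[of _ v]) (auto simp: simplex_value_def)
  next
    case (2 i)
    then have "i \<in> {1..N}" "Suc i \<in> {1..N}"
      using \<open>\<sigma> \<in> sublevel N z _\<close> by (auto simp: edge_in_sublevel)
    moreover have "simplex_value z \<sigma> = z i \<or> simplex_value z \<sigma> = z (Suc i)"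
      using 2 by (auto simp: simplex_value_def max_def)
    ultimately show ?thesis by blast
  qed
qed

lemma sublevel_cong:
  assumes "\<And>v. v \<in> {1..N} \<Longrightarrow> z v \<le> a \<longleftrightarrow> z v \<le> a'"
  shows "sublevel N z a = sublevel N z a'"
proof -
  have "simplex_value z \<sigma> \<le> a \<longleftrightarrow> simplex_value z \<sigma> \<le> a'" if "\<sigma> \<in> interval_complex N" for \<sigma>
    using simplex_value_in_range[OF that, of z] assms by metis
  then show ?thesis unfolding sublevel_def by blast
qed

lemma sorted_value_mono:
  assumes "1 \<le> i" "i \<le> j" "j \<le> N"
  shows "sorted_value N z i \<le> sorted_value N z j"
  unfolding sorted_value_def using assms by (intro sorted_nth_mono) auto

lemma sorted_value_image: "sorted_value N z ` {1..N} = z ` {1..N}"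
proof -
  have "sorted_value N z ` {1..N} = (\<lambda>i. sort (map z [1..<N + 1]) ! i) ` {..<N}"
    unfolding sorted_value_def by (force simp: image_iff Bex_def intro: exI[of _ "Suc _"])
  also have "\<dots> = set (sort (map z [1..<N + 1]))"
    by (auto simp: set_conv_nth)
  also have "\<dots> = z ` {1..N}" by auto
  finally show ?thesis .
qed

text \<open>No value of \<open>z\<close> lies strictly between two consecutive sorted values, so any
  level from the \<open>i\<close>-th up to, but excluding, the next one gives the same complex. For
  \<open>i = 0\<close> and \<open>i = N\<close> the gap is unbounded on one side.\<close>

lemma filtration_eq_sublevel:
  assumes "i = 0 \<or> sorted_value N z i \<le> r" "i = N \<or> r < sorted_value N z (i + 1)" "i \<le> N"
  shows "filtration N z i = sublevel N z r"
proof -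
  let ?s = "sorted_value N z"
  have val: "\<exists>k\<in>{1..N}. z v = ?s k" if "v \<in> {1..N}" for v
    using sorted_value_image[of N z] that by (metis imageE imageI)
  have up: "i + 1 \<le> k" if "r < ?s k \<or> (1 \<le> i \<and> ?s i < ?s k)" "k \<in> {1..N}" for k
  proof (rule ccontr)
    assume "\<not> i + 1 \<le> k"
    then have "k \<le> i" by simp
    then have "?s k \<le> ?s i" using that assms(3) by (intro sorted_value_mono) auto
    then show False using that assms(1) \<open>k \<le> i\<close> by auto
  qed
  show ?thesis
  proof (cases "i = 0")
    case True
    have "r < z v" if v: "v \<in> {1..N}" for v
    proof -
      obtain k where k: "k \<in> {1..N}" "z v = ?s k" using val v by blast
      then have "?s 1 \<le> ?s k" by (intro sorted_value_mono) auto
      then show ?thesis using assms(2) True k v by auto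
    qed
    then have "sublevel N z r = {}"
      using simplex_value_in_range[of _ N z] unfolding sublevel_def by fastforce
    then show ?thesis using True by (simp add: filtration_def)
  next
    case False
    have "z v \<le> ?s i \<longleftrightarrow> z v \<le> r" if v: "v \<in> {1..N}" for v
    proof -
      obtain k where k: "k \<in> {1..N}" "z v = ?s k" using val v by blast
      have "r < z v" if "?s i < z v"
      proof -
        have "i + 1 \<le> k" using up[of k] k that False by auto
        then have "?s (i + 1) \<le> ?s k" using k by (intro sorted_value_mono) auto
        then show ?thesis using assms(2) k \<open>i + 1 \<le> k\<close> by auto
      qed
      then show ?thesis using assms(1) False by force
    qed
    then show ?thesis using False sublevel_cong[of N z "?s i" r] by (simp add: filtration_def)
  qed
qed

section \<open>The diagram as a function of the Betti numbers\<close>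

lemma level_betti_run_starts:
  assumes "filtration N z i = sublevel N z a" "filtration N z j = sublevel N z b" "a \<le> b"
  shows "level_betti TYPE('k::field) N z i j = card (run_starts N z a b)"
  using persistent_betti_sublevel[OF assms(3), where 'k = 'k] assms(1,2) by (simp add: level_betti_def)

text \<open>With \<open>e\<close> below all gaps between the values of \<open>z\<close>, evaluating at \<open>x - e\<close> amounts to taking the
  left limit at \<open>x\<close>, which replaces the reference to the preceding sorted value.\<close>

definition box_mult :: "(real \<Rightarrow> real \<Rightarrow> nat) \<Rightarrow> real \<Rightarrow> real \<Rightarrow> real \<Rightarrow> nat" where
  "box_mult \<beta> e x y = (\<beta> x (y - e) - \<beta> x y) - (\<beta> (x - e) (y - e) - \<beta> (x - e) y)"

text \<open>Summing over values in an arbitrary finite superset \<open>U\<close>, instead of over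
  indices, makes the diagrams of two vectors comparable term by term.\<close>

lemma Dgm_expansion:
  fixes N z U e
  defines "\<beta> \<equiv> \<lambda>a b. card (run_starts N z a b)"
  assumes U: "finite U" "z ` {1..N} \<subseteq> U" and "e > 0" "\<forall>x\<in>U. \<forall>y\<in>U. x < y \<longrightarrow> x + e \<le> y"
  shows "Dgm TYPE('k::field) N z =
     (\<Sum>x\<in>U. \<Sum>y\<in>U. if x < y then replicate_mset (box_mult \<beta> e x y) (x, ereal y) else 0)
     + (\<Sum>x\<in>U. replicate_mset (\<beta> x (Max U) - \<beta> (x - e) (Max U)) (x, \<infinity>))"
proof -
  have e: "e > 0" "\<And>x y. x \<in> U \<Longrightarrow> y \<in> U \<Longrightarrow> x < y \<Longrightarrow> x + e \<le> y"
    using assms by blast+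
  let ?s = "sorted_value N z" and ?V = "z ` {1..N}"
  let ?lb = "level_betti TYPE('k) N z"
  \<comment> \<open>The first index of each block of equal sorted values. These correspond
    bijectively to the values; any other index repeats a filtration step and has multiplicity
    zero.\<close>
  define I where "I = {i \<in> {1..N}. i = 1 \<or> ?s (i - 1) < ?s i}"
  define Q where "Q x y = (if x < y then replicate_mset (box_mult \<beta> e x y) (x, ereal y) else 0)" for x y
  define G where "G i j = replicate_mset (pair_mult TYPE('k) N z i j) (?s i, ereal (?s j))" for i j
  have sV: "?s i \<in> ?V" if "i \<in> {1..N}" for i using sorted_value_image[of N z] that by blast
  have sU: "?s i \<in> U" if "i \<in> {1..N}" for i using sV[OF that] U by blast
  have filt: "filtration N z i = sublevel N z (?s i)" if "i \<in> {1..N}" for i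
    using that by (simp add: filtration_def)
  have filt_prev: "filtration N z (i - 1) = sublevel N z (?s i - e)" if "i \<in> I" for i
  proof (rule filtration_eq_sublevel)
    have i: "i \<in> {1..N}" using that by (simp add: I_def)
    show "i - 1 = 0 \<or> ?s (i - 1) \<le> ?s i - e"
    proof (cases "i = 1")
      case False
      then have "?s (i - 1) < ?s i" "i - 1 \<in> {1..N}" using that by (auto simp: I_def)
      then show ?thesis using e(2)[OF sU[of "i - 1"] sU[OF i]] by simp
    qed simp
    show "i - 1 = N \<or> ?s i - e < ?s (i - 1 + 1)" using i e(1) by auto
    show "i - 1 \<le> N" using i unfolding atLeastAtMost_iff by linarith
  qed
  have filt_same: "filtration N z (i - 1) = filtration N z i" if "i \<in> {1..N} - I" for i
  proof -
    have "i \<noteq> 1" "\<not> ?s (i - 1) < ?s i" "i \<in> {1..N}" using that by (auto simp: I_def)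
    then have "?s (i - 1) = ?s i" using sorted_value_mono[of "i - 1" i N z] by auto
    then show ?thesis using \<open>i \<noteq> 1\<close> \<open>i \<in> {1..N}\<close> by (simp add: filtration_def)
  qed
  have less: "?s i < ?s j" if "i \<in> {1..N}" "j \<in> I" "i < j" for i j
  proof -
    have "?s i \<le> ?s (j - 1)" using that by (intro sorted_value_mono) (auto simp: I_def)
    also have "\<dots> < ?s j" using that by (auto simp: I_def)
    finally show ?thesis .
  qed
  have inj: "inj_on ?s I"
  proof (rule inj_onI)
    fix i j assume ij: "i \<in> I" "j \<in> I" "?s i = ?s j"
    then have "i \<in> {1..N}" "j \<in> {1..N}" by (auto simp: I_def)
    then show "i = j" using less[of i j] less[of j i] ij by (cases i j rule: linorder_cases) auto
  qed
  have image: "?s ` I = ?V"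
  proof
    show "?s ` I \<subseteq> ?V" using sV by (auto simp: I_def)
    show "?V \<subseteq> ?s ` I"
    proof
      fix x assume "x \<in> ?V"
      then have ex: "\<exists>i. i \<in> {1..N} \<and> ?s i = x" using sorted_value_image[of N z] by (metis imageE)
      define i where "i = (LEAST i. i \<in> {1..N} \<and> ?s i = x)"
      have i: "i \<in> {1..N}" "?s i = x" unfolding i_def using LeastI_ex[OF ex] by blast+
      have min: "i \<le> j" if "j \<in> {1..N}" "?s j = x" for j
        unfolding i_def by (rule Least_le) (use that in blast)
      have "i \<in> I"
      proof (rule ccontr)
        assume "i \<notin> I"
        then have "i \<noteq> 1" "?s (i - 1) = ?s i"
          using i sorted_value_mono[of "i - 1" i N z] by (auto simp: I_def)
        moreover have "i - 1 \<in> {1..N}" using \<open>i \<noteq> 1\<close> i(1) unfolding atLeastAtMost_iff by linarith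
        ultimately show False using min[of "i - 1"] i by auto
      qed
      then show "x \<in> ?s ` I" using i by blast
    qed
  qed
  \<comment> \<open>At a point of \<open>U\<close> that is not a value of \<open>z\<close> nothing
    changes between \<open>x - e\<close> and \<open>x\<close>, so its terms vanish.\<close>
  have V_iff: "v \<le> x - e \<longleftrightarrow> v \<le> x" if "v \<in> ?V" "x \<in> U - ?V" for v x
    using e(1) e(2)[of v x] that U(2) by (cases "v < x") auto
  have out1: "\<beta> (x - e) b = \<beta> x b" if "x \<in> U - ?V" for x b
    unfolding \<beta>_def using V_iff[OF _ that] by (subst run_starts_cong[of N z "x - e" x b b]) auto
  have out2: "\<beta> a (y - e) = \<beta> a y" if "y \<in> U - ?V" for a y
    unfolding \<beta>_def using V_iff[OF _ that] by (subst run_starts_cong[of N z a a "y - e" y]) auto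
  have Q0: "Q x y = 0" if "x \<in> U - ?V \<or> y \<in> U - ?V" for x y
    using that out1 out2 by (auto simp: Q_def box_mult_def)
  have G0: "G i j = 0" if "i \<in> {1..N}" "j \<in> {1..N}" "i \<notin> I \<or> j \<notin> I" for i j
    using that filt_same[of i] filt_same[of j] by (auto simp: G_def pair_mult_def level_betti_def)
  have QG: "Q (?s i) (?s j) = G i j" if "i \<in> I" "j \<in> I" "i < j" for i j
  proof -
    have ij: "i \<in> {1..N}" "j \<in> {1..N}" using that by (auto simp: I_def)
    have lt: "?s i < ?s j" using less[OF ij(1) that(2,3)] .
    then have gap: "?s i + e \<le> ?s j" using e(2)[OF sU[OF ij(1)] sU[OF ij(2)]] by simp
    have "?lb i (j - 1) = \<beta> (?s i) (?s j - e)" "?lb i j = \<beta> (?s i) (?s j)"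
      "?lb (i - 1) (j - 1) = \<beta> (?s i - e) (?s j - e)" "?lb (i - 1) j = \<beta> (?s i - e) (?s j)"
      unfolding \<beta>_def using gap e(1) filt ij filt_prev that
      by (intro level_betti_run_starts; simp)+
    then show ?thesis using lt by (simp add: Q_def G_def pair_mult_def box_mult_def)
  qed
  have "(\<Sum>x\<in>U. \<Sum>y\<in>U. Q x y) = (\<Sum>x\<in>?V. \<Sum>y\<in>?V. Q x y)"
  proof (rule sum.mono_neutral_cong_right)
    show "\<forall>x\<in>U - ?V. (\<Sum>y\<in>U. Q x y) = 0" using Q0 by simp
    show "(\<Sum>y\<in>U. Q x y) = (\<Sum>y\<in>?V. Q x y)" for x
      by (rule sum.mono_neutral_right) (use Q0 U in auto)
  qed (use U in auto)
  also have "\<dots> = (\<Sum>i\<in>I. \<Sum>j\<in>I. Q (?s i) (?s j))"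
    unfolding image[symmetric] by (simp add: sum.reindex[OF inj])
  also have "\<dots> = (\<Sum>i = 1..N. \<Sum>j = i + 1..N. G i j)"
  proof (rule sum.mono_neutral_cong_left)
    show "\<forall>i\<in>{1..N} - I. (\<Sum>j = i + 1..N. G i j) = 0" using G0 by (auto intro!: sum.neutral)
    show "(\<Sum>j\<in>I. Q (?s i) (?s j)) = (\<Sum>j = i + 1..N. G i j)" if "i \<in> I" for i
    proof (rule sum.mono_neutral_cong)
      have i: "i \<in> {1..N}" using that by (simp add: I_def)
      show "G i j = 0" if "j \<in> {i + 1..N} - I" for j using G0[OF i, of j] that by auto
      show "Q (?s i) (?s j) = 0" if "j \<in> I - {i + 1..N}" for j
      proof -
        have "?s j \<le> ?s i" using that i by (intro sorted_value_mono) (auto simp: I_def)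
        then show ?thesis by (simp add: Q_def)
      qed
      show "Q (?s i) (?s j) = G i j" if "j \<in> I \<inter> {i + 1..N}" for j
        using QG[OF \<open>i \<in> I\<close>] that by simp
    qed (auto simp: I_def)
  qed (auto simp: I_def)
  finally have finite_part: "(\<Sum>i = 1..N. \<Sum>j = i + 1..N. G i j) = (\<Sum>x\<in>U. \<Sum>y\<in>U. Q x y)" by simp
  let ?E = "\<lambda>x. replicate_mset (\<beta> x (Max U) - \<beta> (x - e) (Max U)) (x, \<infinity>::ereal)"
  let ?H = "\<lambda>i. replicate_mset (essential_mult TYPE('k) N z i) (?s i, \<infinity>::ereal)"
  have "(\<Sum>x\<in>U. ?E x) = (\<Sum>x\<in>?V. ?E x)"
    by (rule sum.mono_neutral_right) (use U out1 in auto)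
  also have "\<dots> = (\<Sum>i\<in>I. ?E (?s i))"
    unfolding image[symmetric] by (simp add: sum.reindex[OF inj])
  also have "\<dots> = (\<Sum>i = 1..N. ?H i)"
  proof (rule sum.mono_neutral_cong_left)
    show "\<forall>i\<in>{1..N} - I. ?H i = 0"
      using filt_same by (auto simp: essential_mult_def level_betti_def)
    show "?E (?s i) = ?H i" if "i \<in> I" for i
    proof -
      have i: "i \<in> {1..N}" using that by (simp add: I_def)
      have le: "?s j \<le> Max U" if "j \<in> {1..N}" for j using sU[OF that] U by simp
      have "filtration N z N = sublevel N z (Max U)"
        using le[of N] i by (intro filtration_eq_sublevel) auto
      then have "?lb i N = \<beta> (?s i) (Max U)" "?lb (i - 1) N = \<beta> (?s i - e) (Max U)"
        unfolding \<beta>_def using le[OF i] e(1) filt[OF i] filt_prev[OF that]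
        by (intro level_betti_run_starts; simp)+
      then show ?thesis by (simp add: essential_mult_def)
    qed
  qed (auto simp: I_def)
  finally show ?thesis
    unfolding Dgm_def finite_part[unfolded G_def] by (simp add: Q_def)
qed

lemma finite_gap:
  fixes U :: "real set"
  assumes "finite U"
  obtains e where "e > 0" "\<forall>x\<in>U. \<forall>y\<in>U. x < y \<longrightarrow> x + e \<le> y"
proof -
  \<comment> \<open>The extra element \<open>1\<close> keeps \<open>D\<close> nonempty when
    \<open>U\<close> has fewer than two points.\<close>
  define D where "D = insert 1 ((\<lambda>(x, y). y - x) ` {(x, y) \<in> U \<times> U. x < y})"
  have "{(x, y) \<in> U \<times> U. x < y} \<subseteq> U \<times> U" by auto
  then have fin: "finite D" using assms finite_subset unfolding D_def by blast
  have "Min D \<in> D" using fin by (intro Min_in) (auto simp: D_def)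
  then have "Min D > 0" by (auto simp: D_def)
  moreover have "x + Min D \<le> y" if "x \<in> U" "y \<in> U" "x < y" for x y
  proof -
    have "y - x \<in> D" using that by (force simp: D_def)
    then show ?thesis using Min_le[OF fin] by fastforce
  qed
  ultimately show thesis using that by blast
qed

lemma Dgm_cong:
  assumes "\<And>a b. a \<le> b \<Longrightarrow> card (run_starts N z a b) = card (run_starts N z' a b)"
  shows "Dgm TYPE('k::field) N z = Dgm TYPE('k) N z'"
proof -
  let ?U = "z ` {1..N} \<union> z' ` {1..N}"
  obtain e where e: "e > 0" "\<forall>x\<in>?U. \<forall>y\<in>?U. x < y \<longrightarrow> x + e \<le> y"
    using finite_gap[of ?U] by auto
  have U: "finite ?U" "z ` {1..N} \<subseteq> ?U" "z' ` {1..N} \<subseteq> ?U" by auto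
  let ?b = "\<lambda>z a b. card (run_starts N z a b)"
  have "box_mult (?b z) e x y = box_mult (?b z') e x y" if "x \<in> ?U" "y \<in> ?U" "x < y" for x y
  proof -
    \<comment> \<open>The Betti numbers are known to agree only for ordered arguments; the choice of
      \<open>e\<close> ensures that only such arguments occur.\<close>
    have "x \<le> y - e" "x - e \<le> y - e" "x - e \<le> y" "x \<le> y" using e(1) e(2)[rule_format, OF that] by linarith+
    then show ?thesis by (simp add: box_mult_def assms)
  qed
  moreover have "?b z x (Max ?U) = ?b z' x (Max ?U)" "?b z (x - e) (Max ?U) = ?b z' (x - e) (Max ?U)"
    if "x \<in> ?U" for x
  proof -
    have "x \<le> Max ?U" using that U(1) by (rule Max_ge[rotated])
    then show "?b z x (Max ?U) = ?b z' x (Max ?U)" "?b z (x - e) (Max ?U) = ?b z' (x - e) (Max ?U)"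
      using e(1) by (intro assms; linarith)+
  qed
  ultimately show ?thesis
    unfolding Dgm_expansion[OF U(1,2) e] Dgm_expansion[OF U(1,3) e]
    by (intro arg_cong2[of _ _ _ _ "(+)"] sum.cong refl) simp_all
qed

lemma Dgm_adapted_eq:
  assumes "finite S" "odd (card S)" "adapted N S t" "adapted N S t'"
    and "\<And>j. j \<in> {1..N} \<Longrightarrow> z j = zigzag c S (t j)" "\<And>j. j \<in> {1..N} \<Longrightarrow> z' j = zigzag c S (t' j)"
  shows "Dgm TYPE('k::field) N z = Dgm TYPE('k) N z'"
proof (rule Dgm_cong)
  fix a b :: real assume "a \<le> b"
  then show "card (run_starts N z a b) = card (run_starts N z' a b)"
    using card_run_starts_le_adapted[of S N t t' a b z c z']
      card_run_starts_le_adapted[of S N t' t a b z' c z] assms by (intro order_antisym) blast+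
qed

section \<open>Critical values occur in the diagram\<close>

lemma filtration_sublevel:
  assumes "i \<le> N" "1 \<le> N"
  obtains a where "filtration N z i = sublevel N z a" "i = 0 \<Longrightarrow> a < sorted_value N z 1"
    "i \<noteq> 0 \<Longrightarrow> a = sorted_value N z i"
proof (cases "i = 0")
  case True
  show ?thesis
    by (rule that[OF filtration_eq_sublevel[of i N z "sorted_value N z 1 - 1"]]) (use assms True in auto)
next
  case False
  then show ?thesis by (intro that[of "sorted_value N z i"]) (auto simp: filtration_def)
qed

text \<open>Raising the upper level can only merge runs. Hence the inner truncated differences in
  \<open>pair_mult\<close> are genuine differences.\<close>

lemma level_betti_antimono:
  assumes "i \<le> j" "1 \<le> j" "j \<le> k" "k \<le> N"
  shows "level_betti TYPE('k::field) N z i k \<le> level_betti TYPE('k) N z i j"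
proof -
  obtain a where a: "filtration N z i = sublevel N z a" "i = 0 \<Longrightarrow> a < sorted_value N z 1"
    "i \<noteq> 0 \<Longrightarrow> a = sorted_value N z i"
    using filtration_sublevel[of i N z] assms by auto
  have le: "sorted_value N z j \<le> sorted_value N z k" "a \<le> sorted_value N z j"
    using assms a(2,3) sorted_value_mono[of j k N z] sorted_value_mono[of i j N z]
      sorted_value_mono[of 1 j N z] by (cases "i = 0"; auto)+
  have f: "filtration N z j = sublevel N z (sorted_value N z j)"
    "filtration N z k = sublevel N z (sorted_value N z k)"
    using assms by (auto simp: filtration_def)
  have "a \<le> sorted_value N z k" using le by linarith
  then show ?thesis
    using level_betti_run_starts[OF a(1) f(1) le(2), where 'k = 'k]
      level_betti_run_starts[OF a(1) f(2), where 'k = 'k]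
      card_mono[OF finite_run_starts run_starts_antimono[OF le(1), of N z a]] by simp
qed

lemma level_betti_0:
  assumes "1 \<le> j" "j \<le> N"
  shows "level_betti TYPE('k::field) N z 0 j = 0"
proof -
  obtain a where a: "filtration N z 0 = sublevel N z a" "a < sorted_value N z 1"
    using filtration_sublevel[of 0 N z] assms by auto
  have f: "filtration N z j = sublevel N z (sorted_value N z j)"
    using assms by (auto simp: filtration_def)
  have le: "a \<le> sorted_value N z j" using a(2) sorted_value_mono[of 1 j N z] assms by auto
  have "a < z v" if v: "v \<in> {1..N}" for v
  proof -
    obtain k where "k \<in> {1..N}" "z v = sorted_value N z k"
      using sorted_value_image[of N z] v by (metis imageE imageI)
    then show ?thesis using a(2) sorted_value_mono[of 1 k N z] by auto
  qed
  then have "run_starts N z a (sorted_value N z j) = {}" by (force simp: run_starts_def)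
  then show ?thesis using level_betti_run_starts[OF a(1) f le, where 'k = 'k] by simp
qed

lemma first_sorted_index:
  assumes "x \<in> z ` {1..N}"
  obtains i where "i \<in> {1..N}" "sorted_value N z i = x" "i = 1 \<or> sorted_value N z (i - 1) < x"
proof -
  let ?Q = "\<lambda>i. i \<in> {1..N} \<and> sorted_value N z i = x"
  have "\<exists>i. ?Q i" using assms sorted_value_image[of N z] by (metis imageE)
  then obtain i where i: "?Q i" "\<And>j. ?Q j \<Longrightarrow> i \<le> j"
    using LeastI_ex[of ?Q] Least_le[of ?Q] by blast
  have "sorted_value N z (i - 1) < x" if "i \<noteq> 1"
  proof -
    have "i - 1 \<in> {1..N}" "1 \<le> i - 1" using i(1) that unfolding atLeastAtMost_iff by linarith+
    then have "sorted_value N z (i - 1) \<noteq> x" using i(2)[of "i - 1"] by auto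
    then show ?thesis using sorted_value_mono[of "i - 1" i N z] i(1) \<open>1 \<le> i - 1\<close> by auto
  qed
  then show thesis using that i(1) by blast
qed

lemma mem_Dgm_I:
  assumes "i \<in> {1..N}"
  shows "j \<in> {i + 1..N} \<Longrightarrow> pair_mult TYPE('k::field) N z i j \<noteq> 0 \<Longrightarrow>
      (sorted_value N z i, ereal (sorted_value N z j)) \<in># Dgm TYPE('k) N z"
    and "essential_mult TYPE('k) N z i \<noteq> 0 \<Longrightarrow> (sorted_value N z i, \<infinity>) \<in># Dgm TYPE('k) N z"
  using assms by (force simp: Dgm_def set_mset_sum)+

text \<open>If no point were born at \<open>x\<close>, the inequalities expressing that the multiplicities vanish
  would telescope, over all death times, to \<open>\<beta>(x, x) \<le> \<beta>(x - \<epsilon>, x)\<close>.\<close>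

lemma birth_in_Dgm:
  assumes x: "x \<in> z ` {1..N}"
    and less: "\<And>a. a < x \<Longrightarrow> card (run_starts N z a x) < card (run_starts N z x x)"
  shows "x \<in> fst ` set_mset (Dgm TYPE('k::field) N z)"
proof (rule ccontr)
  assume no: "x \<notin> fst ` set_mset (Dgm TYPE('k) N z)"
  let ?B = "level_betti TYPE('k) N z" and ?s = "sorted_value N z"
  obtain i where i: "i \<in> {1..N}" "?s i = x" "i = 1 \<or> ?s (i - 1) < x"
    using first_sorted_index[OF x] by blast
  have pm: "pair_mult TYPE('k) N z i j = 0" if "j \<in> {i + 1..N}" for j
    using mem_Dgm_I(1)[OF i(1) that, of z, where 'k = 'k] no i(2) by force
  have em: "essential_mult TYPE('k) N z i = 0"
    using mem_Dgm_I(2)[OF i(1), of z, where 'k = 'k] no i(2) by force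
  have telescope: "?B i i + ?B (i - 1) j \<le> ?B (i - 1) i + ?B i j" if "i \<le> j" "j \<le> N" for j
    using that
  proof (induction j rule: dec_induct)
    case (step j)
    have "?B i j - ?B i (Suc j) \<le> ?B (i - 1) j - ?B (i - 1) (Suc j)"
      using pm[of "Suc j"] step by (auto simp: pair_mult_def)
    moreover have "?B i (Suc j) \<le> ?B i j" "?B (i - 1) (Suc j) \<le> ?B (i - 1) j"
      using step i(1) by (auto intro!: level_betti_antimono)
    moreover have "?B i i + ?B (i - 1) j \<le> ?B (i - 1) i + ?B i j" using step by simp
    ultimately show ?case by linarith
  qed simp
  have "?B i N \<le> ?B (i - 1) N" using em by (simp add: essential_mult_def)
  then have le: "?B i i \<le> ?B (i - 1) i" using telescope[of N] i(1) by simp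
  \<comment> \<open>For \<open>i = 1\<close> the preceding step is the empty complex, a sublevel
    complex below all values.\<close>
  obtain a where a: "filtration N z (i - 1) = sublevel N z a" "a < x"
  proof (cases "i = 1")
    case True
    then show ?thesis using that filtration_sublevel[of 0 N z] i by auto
  next
    case False
    then have "filtration N z (i - 1) = sublevel N z (?s (i - 1))" using i(1) by (auto simp: filtration_def)
    then show ?thesis using that i(3) False by blast
  qed
  have f: "filtration N z i = sublevel N z x" using i by (auto simp: filtration_def)
  show False
    using le less[OF a(2)] level_betti_run_starts[OF f f, where 'k = 'k]
      level_betti_run_starts[OF a(1) f, where 'k = 'k] a(2) by simp
qed

text \<open>If nothing died at \<open>y\<close>, then by induction over the birth index, starting
  from the zero Betti numbers of the empty step, no Betti number would drop between steps
  \<open>j - 1\<close> and \<open>j\<close>. The value \<open>y0\<close> guarantees that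
  \<open>j - 1\<close> is a nonempty step at level at least \<open>y0\<close>, where
  \<open>less\<close> gives a drop.\<close>

lemma death_in_Dgm:
  assumes y: "y \<in> z ` {1..N}" and y0: "y0 \<in> z ` {1..N}" "y0 < y"
    and less: "\<And>b. y0 \<le> b \<Longrightarrow> b < y \<Longrightarrow> card (run_starts N z b y) < card (run_starts N z b b)"
  shows "ereal y \<in> snd ` set_mset (Dgm TYPE('k::field) N z)"
proof (rule ccontr)
  assume no: "ereal y \<notin> snd ` set_mset (Dgm TYPE('k) N z)"
  let ?B = "level_betti TYPE('k) N z" and ?s = "sorted_value N z"
  obtain j where j: "j \<in> {1..N}" "?s j = y" "j = 1 \<or> ?s (j - 1) < y"
    using first_sorted_index[OF y] by blast
  obtain k where k: "k \<in> {1..N}" "?s k = y0" using y0(1) sorted_value_image[of N z] by (metis imageE)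
  have "k < j"
  proof (rule ccontr)
    assume "\<not> k < j"
    then have "?s j \<le> ?s k" using j k by (intro sorted_value_mono) auto
    then show False using j k y0 by simp
  qed
  then have j1: "1 \<le> j - 1" "j - 1 \<le> N" "k \<le> j - 1" using k(1) j(1) unfolding atLeastAtMost_iff by linarith+
  have y0_le: "y0 \<le> ?s (j - 1)" using sorted_value_mono[of k "j - 1" N z] k j1 by auto
  have lt: "?s (j - 1) < y" using j(3) j1 by auto
  have pm: "pair_mult TYPE('k) N z i j = 0" if "i \<in> {1..j - 1}" for i
  proof -
    have "i \<in> {1..N}" "j \<in> {i + 1..N}" using that j1 j(1) by auto
    then show ?thesis using mem_Dgm_I(1)[of i N j z, where 'k = 'k] no j(2) by force
  qed
  have "?B i (j - 1) - ?B i j = 0" if "i \<le> j - 1" for i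
    using that
  proof (induction i)
    case 0
    then show ?case using level_betti_0[of "j - 1" N z, where 'k = 'k] j1 by simp
  next
    case (Suc i)
    then show ?case using pm[of "Suc i"] by (auto simp: pair_mult_def)
  qed
  then have le: "?B (j - 1) (j - 1) \<le> ?B (j - 1) j" by simp
  have f: "filtration N z (j - 1) = sublevel N z (?s (j - 1))" "filtration N z j = sublevel N z y"
    using j(1,2) j1 by (auto simp: filtration_def)
  show False
    using le less[OF y0_le lt] lt level_betti_run_starts[OF f(1) f(1), where 'k = 'k]
      level_betti_run_starts[OF f, where 'k = 'k] by simp
qed

text \<open>The elements of \<open>S\<close> in increasing order, numbered from \<open>1\<close>; the largest one is repeated
  beyond \<open>card S\<close>.\<close>

definition left_packed :: "real set \<Rightarrow> nat \<Rightarrow> real" where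
  "left_packed S j = sorted_list_of_set S ! (min j (card S) - 1)"

lemma left_packed_enumeration:
  assumes "finite S"
  shows "k \<in> {1..card S} \<Longrightarrow> left_packed S k \<in> S"
    and "1 \<le> k \<Longrightarrow> k < l \<Longrightarrow> l \<le> card S \<Longrightarrow> left_packed S k < left_packed S l"
    and "p \<in> S \<Longrightarrow> \<exists>k\<in>{1..card S}. left_packed S k = p"
    and "card S \<le> k \<Longrightarrow> left_packed S k = left_packed S (card S)"
proof -
  let ?L = "sorted_list_of_set S"
  have L: "length ?L = card S" "set ?L = S" "sorted_wrt (<) ?L"
    using assms by (auto simp: strict_sorted_iff)
  show "left_packed S k \<in> S" if "k \<in> {1..card S}"
  proof -
    have "min k (card S) - 1 < length ?L" using that L(1) by auto
    from nth_mem[OF this] show ?thesis unfolding left_packed_def L(2) .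
  qed
  show "left_packed S k < left_packed S l" if "1 \<le> k" "k < l" "l \<le> card S"
  proof -
    have "k - 1 < l - 1" "l - 1 < length ?L" "min k (card S) = k" "min l (card S) = l" using that L(1) by auto
    then show ?thesis unfolding left_packed_def by (simp add: sorted_wrt_nth_less[OF L(3)])
  qed
  show "\<exists>k\<in>{1..card S}. left_packed S k = p" if "p \<in> S"
  proof -
    obtain i where "i < length ?L" "?L ! i = p" using \<open>p \<in> S\<close>
      by (metis L(2) in_set_conv_nth)
    then show ?thesis using L(1) by (intro bexI[of _ "Suc i"]) (auto simp: left_packed_def)
  qed
  show "left_packed S k = left_packed S (card S)" if "card S \<le> k"
    using that by (simp add: left_packed_def)
qed

lemma zigzag_left_packed_step:
  assumes "finite S" "1 \<le> k" "k < card S"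
  shows "zigzag c S (left_packed S (Suc k)) - zigzag c S (left_packed S k)
    = (-1) ^ Suc k * (left_packed S (Suc k) - left_packed S k)"
proof -
  let ?e = "left_packed S"
  note e = left_packed_enumeration[OF assms(1)]
  have le: "?e i \<le> ?e j" if "1 \<le> i" "i \<le> j" "j \<le> card S" for i j
    using e(2)[of i j] that by (cases "i = j") auto
  have "{p \<in> S. p \<le> ?e k} = ?e ` {1..k}"
  proof (intro equalityI subsetI)
    fix p assume "p \<in> {p \<in> S. p \<le> ?e k}"
    then obtain i where i: "i \<in> {1..card S}" "?e i = p" "?e i \<le> ?e k" using e(3)[of p] by auto
    then have "\<not> k < i" using e(2)[of k i] assms(2) by auto
    then show "p \<in> ?e ` {1..k}" using i by auto
  next
    fix p assume "p \<in> ?e ` {1..k}"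
    then obtain i where "i \<in> {1..k}" "p = ?e i" by blast
    then show "p \<in> {p \<in> S. p \<le> ?e k}" using e(1)[of i] le[of i k] assms by auto
  qed
  moreover have "inj_on ?e {1..k}"
  proof (rule inj_onI)
    fix i j assume "i \<in> {1..k}" "j \<in> {1..k}" "?e i = ?e j"
    then show "i = j" using e(2)[of i j] e(2)[of j i] assms by (cases i j rule: linorder_cases) auto
  qed
  ultimately have "card {p \<in> S. p \<le> ?e k} = k" by (simp add: card_image)
  moreover have "p \<le> ?e k \<or> ?e (Suc k) \<le> p" if "p \<in> S" for p
  proof -
    obtain i where i: "i \<in> {1..card S}" "?e i = p" using e(3) \<open>p \<in> S\<close> by blast
    then show ?thesis using le[of i k] le[of "Suc k" i] assms by (cases "i \<le> k") auto
  qed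
  moreover have "?e k \<le> ?e (Suc k)" using le assms by simp
  ultimately show ?thesis using zigzag_gap[OF assms(1), of "?e k" "?e (Suc k)"] by simp
qed

text \<open>The vector visits the turning points in order, so odd positions are local minima and
  even ones local maxima. A minimum starts a run at its own level, and a maximum merges its two
  neighbouring runs.\<close>

lemma zigzag_left_packed_critical:
  assumes S: "finite S" "odd (card S)" "card S \<le> N"
    and z: "\<And>j. j \<in> {1..N} \<Longrightarrow> z j = zigzag c S (left_packed S j)" and "j \<in> {1..N}"
  shows "z j \<in> fst ` set_mset (Dgm TYPE('k::field) N z) \<or> ereal (z j) \<in> snd ` set_mset (Dgm TYPE('k) N z)"
proof -
  let ?M = "card S"
  \<comment> \<open>Positions beyond \<open>?M\<close> repeat the last turning point, so
    \<open>j\<close> may be replaced by \<open>k\<close>.\<close>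
  define k where "k = min j ?M"
  have M: "1 \<le> ?M" using S(2) by (cases "?M") auto
  have k: "1 \<le> k" "k \<le> ?M" "k \<le> N" using assms(5) M S(3) by (auto simp: k_def)
  have tail: "z i = z ?M" if "?M \<le> i" "i \<le> N" for i
    using z[of i] z[of ?M] left_packed_enumeration(4)[OF S(1), of i] that M by simp
  have zjk: "z j = z k"
    using tail[of j] assms(5) by (auto simp: k_def min_def)
  have step: "z (Suc i) - z i = (-1) ^ Suc i * (left_packed S (Suc i) - left_packed S i)"
    "left_packed S i < left_packed S (Suc i)" if "1 \<le> i" "i < ?M" for i
    using zigzag_left_packed_step[OF S(1) that, of c] z[of i] z[of "Suc i"] that S(3)
      left_packed_enumeration(2)[OF S(1), of i "Suc i"] by auto
  have up: "z i < z (Suc i)" if "1 \<le> i" "i < ?M" "odd i" for i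
    using step[of i] that by (simp add: power_Suc)
  have down: "z (Suc i) < z i" if "1 \<le> i" "i < ?M" "even i" for i
    using step[of i] that by (simp add: power_Suc)
  show ?thesis
  proof (cases "odd k")
    case True
    have "card (run_starts N z a (z k)) < card (run_starts N z (z k) (z k))" if "a < z k" for a
    proof (rule card_run_starts_less_birth[of k])
      have "\<exists>x. u < x \<and> x < k \<and> z k < z x" if u: "u \<in> {1..<k}" "z u \<le> z k" for u
      proof -
        have "1 \<le> k - 1" "k - 1 < ?M" "even (k - 1)" using u(1) True k by auto
        then have "z k < z (k - 1)" using down[of "k - 1"] u by simp
        then show ?thesis using u by (intro exI[of _ "k - 1"]) (cases "u = k - 1", auto)
      qed
      then show "k \<in> run_starts N z (z k) (z k)" using k by (auto simp: run_starts_def)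
      \<comment> \<open>Either the next position is already higher, or \<open>k\<close> is the last
        turning point and all later values equal \<open>z k\<close>, which exceeds
        \<open>a\<close>.\<close>
      show "\<exists>w\<in>{k..v}. z k < z w" if v: "k \<le> v" "v \<le> N" "z v \<le> a" for v
      proof (cases "k < ?M")
        case True
        have "v \<noteq> k" using v \<open>a < z k\<close> by auto
        then show ?thesis using up[of k] k True \<open>odd k\<close> v by (intro bexI[of _ "Suc k"]) auto
      next
        case False
        then have "z v = z k" using tail[of v] k v by simp
        then show ?thesis using v \<open>a < z k\<close> by simp
      qed
    qed (use that in auto)
    then have "z k \<in> fst ` set_mset (Dgm TYPE('k) N z)"
      using k by (intro birth_in_Dgm) auto
    then show ?thesis using zjk by simp
  next
    case False
    \<comment> \<open>An even \<open>k\<close> is neither \<open>1\<close> nor the odd number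
      \<open>?M\<close>, so it has a lower neighbour on each side.\<close>
    then have kM: "k < ?M" using k S(2) by (cases "k = ?M") auto
    have k1: "1 < k" using False k by (cases "k = 1") auto
    have dn: "z (Suc k) < z k" using down[of k] k kM False by simp
    have up': "z (k - 1) < z k" using up[of "k - 1"] k1 kM False by simp
    define y0 where "y0 = max (z (k - 1)) (z (k + 1))"
    have "ereal (z k) \<in> snd ` set_mset (Dgm TYPE('k) N z)"
    proof (rule death_in_Dgm)
      show "z k \<in> z ` {1..N}" using k by auto
      have "k - 1 \<in> {1..N}" "k + 1 \<in> {1..N}" using k1 kM S(3) unfolding atLeastAtMost_iff by linarith+
      then show "y0 \<in> z ` {1..N}" unfolding y0_def max_def by (simp split: if_split)
      show "y0 < z k" using dn up' by (simp add: y0_def)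
      show "card (run_starts N z b (z k)) < card (run_starts N z b b)" if "y0 \<le> b" "b < z k" for b
        using that k1 kM S(3) by (intro card_run_starts_less_death[of k]) (auto simp: y0_def)
    qed
    then show ?thesis using zjk by simp
  qed
qed

section \<open>The space of reparametrisations\<close>

definition numbered_vec :: "nat \<Rightarrow> (nat \<Rightarrow> 'n::finite) \<Rightarrow> (nat \<Rightarrow> real) \<Rightarrow> real ^ 'n" where
  "numbered_vec N ix f = (\<chi> i. f (inv_into {1..N} ix i))"

definition adapted_vecs :: "nat \<Rightarrow> (nat \<Rightarrow> 'n::finite) \<Rightarrow> real set \<Rightarrow> (real ^ 'n) set" where
  "adapted_vecs N ix S = {t. adapted N S (\<lambda>j. t $ ix j)}"

lemma numbered_vec_nth:
  assumes "bij_betw ix {1..N} (UNIV :: 'n::finite set)" "j \<in> {1..N}"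
  shows "numbered_vec N ix f $ ix j = f j"
  using assms by (simp add: numbered_vec_def bij_betw_inv_into_left)

lemma index_cases:
  assumes "bij_betw ix {1..N} (UNIV :: 'n::finite set)"
  obtains j where "j \<in> {1..N}" "i = ix j"
  using assms by (metis UNIV_I bij_betw_imp_surj_on imageE)

lemma adapted_cong:
  assumes "\<And>j. j \<in> {1..N} \<Longrightarrow> t j = t' j"
  shows "adapted N S t \<longleftrightarrow> adapted N S t'"
proof -
  have "t ` {1..N} = t' ` {1..N}" using assms by (rule image_cong[OF refl])
  then show ?thesis using assms by (simp add: adapted_def mono_on_def)
qed

lemma adaptedI:
  assumes "\<And>i j. i \<in> {1..N} \<Longrightarrow> j \<in> {1..N} \<Longrightarrow> i \<le> j \<Longrightarrow> t i \<le> t j"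
    and "\<And>p. p \<in> S \<Longrightarrow> \<exists>j\<in>{1..N}. t j = p"
  shows "adapted N S t"
  using assms unfolding adapted_def mono_on_def by blast

lemma numbered_vec_adapted_iff:
  assumes "bij_betw ix {1..N} (UNIV :: 'n::finite set)"
  shows "numbered_vec N ix t \<in> adapted_vecs N ix S \<longleftrightarrow> adapted N S t"
proof -
  have "adapted N S (\<lambda>j. numbered_vec N ix t $ ix j) \<longleftrightarrow> adapted N S t"
    by (rule adapted_cong) (rule numbered_vec_nth[OF assms])
  then show ?thesis by (simp add: adapted_vecs_def)
qed

text \<open>Once an assignment \<open>J\<close> fixes which coordinate equals which point of
  \<open>S\<close>, all conditions are linear. Restricting assignments to extensional functions
  leaves finitely many.\<close>

lemma adapted_vecs_union_polyhedra:
  assumes "finite S"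
  obtains \<F> :: "(real ^ 'n::finite) set set"
  where "finite \<F>" "\<And>T. T \<in> \<F> \<Longrightarrow> polyhedron T" "adapted_vecs N ix S = \<Union> \<F>"
proof -
  define P where "P J = (\<Inter>(i, j)\<in>{(i, j). i \<in> {1..N} \<and> j \<in> {1..N} \<and> i \<le> j}. {t :: real ^ 'n. (axis (ix i) 1 - axis (ix j) 1) \<bullet> t \<le> 0})
     \<inter> (\<Inter>p\<in>S. {t. axis (ix (J p)) 1 \<bullet> t = p})" for J :: "real \<Rightarrow> nat"
  have P_iff: "t \<in> P J \<longleftrightarrow> (\<forall>i\<in>{1..N}. \<forall>j\<in>{1..N}. i \<le> j \<longrightarrow> t $ ix i \<le> t $ ix j) \<and> (\<forall>p\<in>S. t $ ix (J p) = p)" for t J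
    unfolding P_def by (auto simp: inner_axis' inner_diff_left)
  have fin: "finite {(i, j). i \<in> {1..N} \<and> j \<in> {1..N} \<and> i \<le> j}"
    by (rule finite_subset[of _ "{1..N} \<times> {1..N}"]) auto
  show thesis
  proof (rule that[of "P ` (S \<rightarrow>\<^sub>E {1..N})"])
    show "finite (P ` (S \<rightarrow>\<^sub>E {1..N}))" using assms by (intro finite_imageI finite_PiE) auto
    show "polyhedron T" if "T \<in> P ` (S \<rightarrow>\<^sub>E {1..N})" for T
    proof -
      obtain J where T: "T = P J" using \<open>T \<in> _\<close> by blast
      show ?thesis unfolding T P_def using fin assms
        by (intro polyhedron_Int polyhedron_Inter finite_imageI)
          (auto simp: polyhedron_halfspace_le polyhedron_hyperplane)
    qed
    show "adapted_vecs N ix S = \<Union> (P ` (S \<rightarrow>\<^sub>E {1..N}))"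
    proof (intro equalityI subsetI)
      fix t assume "t \<in> adapted_vecs N ix S"
      then have t: "adapted N S (\<lambda>j. t $ ix j)" by (simp add: adapted_vecs_def)
      then obtain J where J: "\<And>p. p \<in> S \<Longrightarrow> J p \<in> {1..N} \<and> t $ ix (J p) = p"
        using adaptedD(2)[OF t] by metis
      then have "t \<in> P (restrict J S)" using adaptedD(1)[OF t] unfolding P_iff by auto
      moreover have "restrict J S \<in> S \<rightarrow>\<^sub>E {1..N}" using J by auto
      ultimately show "t \<in> \<Union> (P ` (S \<rightarrow>\<^sub>E {1..N}))" by blast
    next
      fix t assume "t \<in> \<Union> (P ` (S \<rightarrow>\<^sub>E {1..N}))"
      then obtain J where J: "J \<in> S \<rightarrow>\<^sub>E {1..N}" "t \<in> P J" by blast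
      have "adapted N S (\<lambda>j. t $ ix j)"
      proof (rule adaptedI)
        show "\<exists>j\<in>{1..N}. t $ ix j = p" if "p \<in> S" for p
          using J that unfolding P_iff by (intro bexI[of _ "J p"]) (auto simp: PiE_mem)
      qed (use J in \<open>simp add: P_iff\<close>)
      then show "t \<in> adapted_vecs N ix S" by (simp add: adapted_vecs_def)
    qed
  qed
qed

section \<open>Closedness, maxima and segments\<close>

lemma closed_adapted_vecs:
  assumes "finite S"
  shows "closed (adapted_vecs N ix S :: (real ^ 'n::finite) set)"
proof -
  obtain \<F> :: "(real ^ 'n) set set" where "finite \<F>" "\<And>T. T \<in> \<F> \<Longrightarrow> polyhedron T"
    "adapted_vecs N ix S = \<Union> \<F>"
    using adapted_vecs_union_polyhedra[OF assms] by metis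
  then show ?thesis by (auto intro: polyhedron_imp_closed)
qed

text \<open>If \<open>s\<close> equals \<open>p\<close> at \<open>i\<close> and \<open>t\<close>
  equals \<open>p\<close> at \<open>j\<close>, then at \<open>min i j\<close> both are at most
  \<open>p\<close> by monotonicity, and one of them equals \<open>p\<close>.\<close>

lemma adapted_vecs_max:
  assumes "s \<in> adapted_vecs N ix S" "t \<in> adapted_vecs N ix S"
  shows "(\<chi> i. max (s $ i) (t $ i)) \<in> adapted_vecs N ix S"
proof -
  have s: "adapted N S (\<lambda>j. s $ ix j)" and t: "adapted N S (\<lambda>j. t $ ix j)"
    using assms by (auto simp: adapted_vecs_def)
  have "adapted N S (\<lambda>j. max (s $ ix j) (t $ ix j))"
  proof (rule adaptedI)
    fix i j assume "i \<in> {1..N}" "j \<in> {1..N}" "i \<le> j"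
    then show "max (s $ ix i) (t $ ix i) \<le> max (s $ ix j) (t $ ix j)"
      using adaptedD(1)[OF s, of i j] adaptedD(1)[OF t, of i j] by linarith
  next
    fix p assume "p \<in> S"
    then obtain i j where i: "i \<in> {1..N}" "s $ ix i = p" and j: "j \<in> {1..N}" "t $ ix j = p"
      using adaptedD(2)[OF s] adaptedD(2)[OF t] by blast
    have "max (s $ ix (min i j)) (t $ ix (min i j)) = p"
      using adaptedD(1)[OF s j(1) i(1)] adaptedD(1)[OF t i(1) j(1)] i(2) j(2)
      by (cases "i \<le> j") (auto simp: min_def max_def)
    then show "\<exists>j\<in>{1..N}. max (s $ ix j) (t $ ix j) = p"
      using i(1) j(1) by (intro bexI[of _ "min i j"]) auto
  qed
  then show ?thesis by (simp add: adapted_vecs_def)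
qed

text \<open>Monotonicity passes to convex combinations. Attaining \<open>p\<close> does so if both
  ends attain it at the same coordinate.\<close>

lemma closed_segment_subset_adapted_vecs:
  assumes "s \<in> adapted_vecs N ix S" "t \<in> adapted_vecs N ix S"
    and fixed: "\<And>p. p \<in> S \<Longrightarrow> \<exists>j\<in>{1..N}. s $ ix j = p \<and> t $ ix j = p"
  shows "closed_segment s t \<subseteq> adapted_vecs N ix S"
proof
  fix x assume "x \<in> closed_segment s t"
  then obtain u where u: "0 \<le> u" "u \<le> 1" "x = (1 - u) *\<^sub>R s + u *\<^sub>R t"
    by (auto simp: in_segment)
  have s: "adapted N S (\<lambda>j. s $ ix j)" and t: "adapted N S (\<lambda>j. t $ ix j)"
    using assms by (auto simp: adapted_vecs_def)
  have "adapted N S (\<lambda>j. x $ ix j)"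
  proof (rule adaptedI)
    fix i j assume "i \<in> {1..N}" "j \<in> {1..N}" "i \<le> j"
    then show "x $ ix i \<le> x $ ix j"
      using adaptedD(1)[OF s, of i j] adaptedD(1)[OF t, of i j] u
      by (auto intro!: add_mono mult_left_mono)
  next
    fix p assume "p \<in> S"
    then obtain j where "j \<in> {1..N}" "s $ ix j = p" "t $ ix j = p" using fixed by blast
    then have "x $ ix j = (1 - u) * p + u * p" using u(3) by simp
    then have "x $ ix j = p" by (simp add: algebra_simps)
    then show "\<exists>j\<in>{1..N}. x $ ix j = p" using \<open>j \<in> {1..N}\<close> by blast
  qed
  then show "x \<in> adapted_vecs N ix S" by (simp add: adapted_vecs_def)
qed

section \<open>Paths through shifted enumerations of the turning points\<close>

lemma path_component_adapted_single_change:
  assumes ix: "bij_betw ix {1..N} (UNIV :: 'n::finite set)" and st: "adapted N S s" "adapted N S t"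
    and eq: "\<And>j. j \<in> {1..N} \<Longrightarrow> j \<noteq> k \<Longrightarrow> s j = t j"
  shows "path_component (adapted_vecs N ix S) (numbered_vec N ix s) (numbered_vec N ix t)"
proof -
  let ?s = "numbered_vec N ix s" and ?t = "numbered_vec N ix t"
  have "closed_segment ?s ?t \<subseteq> adapted_vecs N ix S"
  proof (rule closed_segment_subset_adapted_vecs)
    \<comment> \<open>If one vector attains \<open>p\<close> away from \<open>k\<close>, so does the
      other at the same coordinate; otherwise both attain it at \<open>k\<close>.\<close>
    fix p assume "p \<in> S"
    then obtain i j where i: "i \<in> {1..N}" "s i = p" and j: "j \<in> {1..N}" "t j = p"
      using adaptedD(2)[OF st(1)] adaptedD(2)[OF st(2)] by metis
    have "\<exists>j\<in>{1..N}. s j = p \<and> t j = p"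
      using i j eq[of i] eq[of j] by (cases "i = k"; cases "j = k") auto
    then show "\<exists>j\<in>{1..N}. ?s $ ix j = p \<and> ?t $ ix j = p"
      using numbered_vec_nth[OF ix] by metis
  qed (use st numbered_vec_adapted_iff[OF ix] in auto)
  then show ?thesis
    unfolding path_component_def by (intro exI[of _ "linepath ?s ?t"]) auto
qed

text \<open>The least point of \<open>S\<close> fills the first \<open>c + 1\<close> coordinates,
  the others follow in order, and the greatest fills the rest. Among the adapted vectors with
  coordinates in the hull of \<open>S\<close>, shift \<open>0\<close> is the greatest and shift
  \<open>N - card S\<close> the least.\<close>

definition shifted_packing :: "real set \<Rightarrow> nat \<Rightarrow> nat \<Rightarrow> real" where
  "shifted_packing S c j = left_packed S (max 1 (j - c))"

lemma left_packed_mono: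
  assumes "finite S" "1 \<le> i" "i \<le> j"
  shows "left_packed S i \<le> left_packed S j"
proof -
  note e = left_packed_enumeration[OF assms(1)]
  consider "i = j" | "i < j" "j \<le> card S" | "i < card S" "card S < j" | "card S \<le> i" "card S \<le> j"
    using assms by linarith
  then show ?thesis
    using e(2)[of i j] e(2)[of i "card S"] e(4)[of i] e(4)[of j] assms(2) by cases auto
qed

text \<open>The shift by \<open>c + 1\<close> is turned into the shift by \<open>c\<close> by raising one coordinate at a time.\<close>

lemma adapted_shift_mixture:
  assumes S: "finite S" "card S \<noteq> 0" and "i \<le> card S"
    and c: "c + card S \<le> N" "i < card S \<Longrightarrow> c + 1 + card S \<le> N"
  shows "adapted N S (\<lambda>j. if j \<le> c + i then shifted_packing S c j else shifted_packing S (c + 1) j)"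
proof (rule adaptedI)
  fix j k :: nat assume "j \<le> k" "j \<in> {1..N}"
  moreover have "max 1 (j - c) \<le> max 1 (k - (c + 1)) \<or> k \<le> c + i" if "j \<le> c + i" "c + i < k"
    using that by auto
  ultimately show "(if j \<le> c + i then shifted_packing S c j else shifted_packing S (c + 1) j)
      \<le> (if k \<le> c + i then shifted_packing S c k else shifted_packing S (c + 1) k)"
    unfolding shifted_packing_def by (auto intro!: left_packed_mono[OF S(1)])
next
  fix p assume "p \<in> S"
  then obtain l where l: "l \<in> {1..card S}" "left_packed S l = p"
    using left_packed_enumeration(3)[OF S(1)] by blast
  show "\<exists>j\<in>{1..N}. (if j \<le> c + i then shifted_packing S c j else shifted_packing S (c + 1) j) = p"
  proof (cases "l \<le> i")
    case True
    then show ?thesis using l c assms(3) by (intro bexI[of _ "c + l"]) (auto simp: shifted_packing_def)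
  next
    case False
    then show ?thesis using l c assms(3) by (intro bexI[of _ "c + 1 + l"]) (auto simp: shifted_packing_def)
  qed
qed

lemma adapted_shifted_packing:
  assumes "finite S" "card S \<noteq> 0" "c + card S \<le> N"
  shows "adapted N S (shifted_packing S c)"
proof -
  \<comment> \<open>Beyond \<open>c + card S\<close> both shifts have reached the greatest
    point.\<close>
  have "(if j \<le> c + card S then shifted_packing S c j else shifted_packing S (c + 1) j) = shifted_packing S c j" for j
    using left_packed_enumeration(4)[OF assms(1), of "j - c"] left_packed_enumeration(4)[OF assms(1), of "j - (c + 1)"]
      assms(2) by (auto simp: shifted_packing_def max_def)
  then show ?thesis using adapted_shift_mixture[OF assms(1,2) order_refl assms(3)] by simp
qed

lemma path_component_shifted_packing:
  assumes ix: "bij_betw ix {1..N} (UNIV :: 'n::finite set)"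
    and S: "finite S" "card S \<noteq> 0" and "c + card S \<le> N"
  shows "path_component (adapted_vecs N ix S) (numbered_vec N ix (shifted_packing S c))
    (numbered_vec N ix (shifted_packing S 0))"
  using assms(4)
proof (induction c)
  case 0
  then show ?case using adapted_shifted_packing[OF S, of 0 N] numbered_vec_adapted_iff[OF ix]
    by (auto intro: path_component_refl)
next
  case (Suc c)
  \<comment> \<open>As \<open>i\<close> runs from \<open>0\<close> to \<open>card S\<close> the
    mixture passes from shift \<open>c + 1\<close> to shift \<open>c\<close>; the step from
    \<open>i\<close> to \<open>Suc i\<close> affects only coordinate
    \<open>c + Suc i\<close>.\<close>
  let ?m = "\<lambda>i j. if j \<le> c + i then shifted_packing S c j else shifted_packing S (c + 1) j"
  have "path_component (adapted_vecs N ix S) (numbered_vec N ix (?m 0)) (numbered_vec N ix (?m i))"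
    if "i \<le> card S" for i
    using that
  proof (induction i)
    case 0
    have "adapted N S (?m 0)" using Suc.prems by (intro adapted_shift_mixture S) auto
    then show ?case using numbered_vec_adapted_iff[OF ix] by (intro path_component_refl) blast
  next
    case (Suc i)
    have "path_component (adapted_vecs N ix S) (numbered_vec N ix (?m i)) (numbered_vec N ix (?m (Suc i)))"
    proof (rule path_component_adapted_single_change[OF ix, where k = "c + Suc i"])
      show "adapted N S (?m i)" "adapted N S (?m (Suc i))"
        using Suc.prems \<open>Suc c + card S \<le> N\<close> by (intro adapted_shift_mixture S; simp)+
    qed auto
    then show ?case by (rule path_component_trans[OF Suc.IH[OF Suc_leD[OF Suc.prems]]])
  qed
  from this[of "card S"]
  have "path_component (adapted_vecs N ix S) (numbered_vec N ix (?m 0)) (numbered_vec N ix (?m (card S)))"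
    by simp
  moreover have "?m 0 = shifted_packing S (Suc c)"
    by (rule ext) (auto simp: shifted_packing_def max_def)
  moreover have "?m (card S) = shifted_packing S c"
  proof
    fix j
    show "?m (card S) j = shifted_packing S c j"
      using left_packed_enumeration(4)[OF S(1), of "j - c"] left_packed_enumeration(4)[OF S(1), of "j - (c + 1)"]
        S(2) by (auto simp: shifted_packing_def max_def)
  qed
  ultimately have "path_component (adapted_vecs N ix S) (numbered_vec N ix (shifted_packing S (Suc c)))
      (numbered_vec N ix (shifted_packing S c))" by (simp only:)
  then show ?case using Suc.IH Suc.prems by (auto intro: path_component_trans)
qed

section \<open>Extremal adapted vectors and contractibility\<close>

lemma adapted_le_left_packed:
  assumes "finite S" "adapted N S t" "1 \<le> j" "j \<le> card S" "j \<le> N"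
  shows "t j \<le> left_packed S j"
  using assms(3-5)
proof (induction j rule: less_induct)
  case (less j)
  have "left_packed S j \<in> S" using less by (intro left_packed_enumeration(1)[OF assms(1)]) auto
  then obtain i where i: "i \<in> {1..N}" "t i = left_packed S j" using adaptedD(2)[OF assms(2)] by blast
  \<comment> \<open>By induction the coordinates before \<open>j\<close> stay below the
    \<open>j\<close>-th turning point, so it is attained at \<open>j\<close> or later.\<close>
  have "\<not> i < j"
  proof
    assume "i < j"
    then show False
      using less.IH[of i] less.prems i left_packed_enumeration(2)[OF assms(1), of i j] by auto
  qed
  then show ?case using adaptedD(1)[OF assms(2), of j i] i less.prems by auto
qed

text \<open>The mirror image of \<open>adapted_le_left_packed\<close>, with positions counted from
  the right end.\<close>

lemma adapted_ge_right_packed: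
  assumes "finite S" "adapted N S t" "k < card S" "k < N"
  shows "left_packed S (card S - k) \<le> t (N - k)"
  using assms(3,4)
proof (induction k rule: less_induct)
  case (less k)
  have "left_packed S (card S - k) \<in> S" using less by (intro left_packed_enumeration(1)[OF assms(1)]) auto
  then obtain i where i: "i \<in> {1..N}" "t i = left_packed S (card S - k)"
    using adaptedD(2)[OF assms(2)] by blast
  have "\<not> N - k < i"
  proof
    assume *: "N - k < i"
    then have k: "N - i < k" "N - (N - i) = i" using i(1) by auto
    then have "left_packed S (card S - (N - i)) \<le> t i" using less.IH[of "N - i"] less.prems by simp
    moreover have "left_packed S (card S - k) < left_packed S (card S - (N - i))"
      using k less.prems by (intro left_packed_enumeration(2)[OF assms(1)]) auto
    ultimately show False using i(2) by simp
  qed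
  then show ?case using adaptedD(1)[OF assms(2), of i "N - k"] i less.prems by auto
qed

lemma adapted_card_le:
  assumes "adapted N S t"
  shows "card S \<le> N"
  using assms surj_card_le[of "{1..N}" S t] by (auto simp: adapted_def)

lemma contractible_adapted_vecs:
  assumes ix: "bij_betw ix {1..N} (UNIV :: 'n::finite set)" and S: "finite S" "card S \<noteq> 0"
  shows "contractible (adapted_vecs N ix S)"
proof (cases "adapted_vecs N ix S = {}")
  case False
  let ?T = "adapted_vecs N ix S" and ?M = "card S"
  have MN: "?M \<le> N" using False adapted_card_le by (auto simp: adapted_vecs_def)
  define lo where "lo = left_packed S 1"
  define hi where "hi = left_packed S ?M"
  define clamp where "clamp t = (\<chi> i. max lo (min hi (t $ i)))" for t :: "real ^ 'n"
  have S_bounds: "lo \<le> p" "p \<le> hi" if "p \<in> S" for p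
  proof -
    obtain l where "l \<in> {1..?M}" "left_packed S l = p" using left_packed_enumeration(3)[OF S(1) \<open>p \<in> S\<close>] by blast
    then show "lo \<le> p" "p \<le> hi"
      using left_packed_mono[OF S(1), of 1 l] left_packed_mono[OF S(1), of l ?M] by (auto simp: lo_def hi_def)
  qed
  have clamp_T: "clamp t \<in> ?T" and seg: "closed_segment t (clamp t) \<subseteq> ?T" if "t \<in> ?T" for t
  proof -
    have t: "adapted N S (\<lambda>j. t $ ix j)" using that by (simp add: adapted_vecs_def)
    \<comment> \<open>Clamping fixes the points of \<open>S\<close>, so they are attained at the
      same coordinates and the straight-line homotopy stays in \<open>?T\<close>.\<close>
    have fixed: "\<exists>j\<in>{1..N}. t $ ix j = p \<and> clamp t $ ix j = p" if "p \<in> S" for p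
      using adaptedD(2)[OF t that] S_bounds[OF that] by (auto simp: clamp_def)
    have "adapted N S (\<lambda>j. clamp t $ ix j)"
    proof (rule adaptedI)
      fix i j assume "i \<in> {1..N}" "j \<in> {1..N}" "i \<le> j"
      then show "clamp t $ ix i \<le> clamp t $ ix j"
        using adaptedD(1)[OF t, of i j] unfolding clamp_def by (auto intro: max.mono min.mono)
    qed (use fixed in blast)
    then show "clamp t \<in> ?T" by (simp add: adapted_vecs_def)
    then show "closed_segment t (clamp t) \<subseteq> ?T"
      using closed_segment_subset_adapted_vecs[OF that] fixed by blast
  qed
  have cont_clamp: "continuous_on A clamp" for A
    unfolding clamp_def by (intro continuous_intros)
  have "homotopic_with_canon (\<lambda>x. True) ?T ?T id clamp"
    by (rule homotopic_with_linear) (use seg cont_clamp in auto)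
  moreover have "homotopic_with_canon (\<lambda>x. True) ?T ?T clamp (\<lambda>x. numbered_vec N ix (shifted_packing S 0))"
  proof -
    obtain \<gamma> where \<gamma>: "path \<gamma>" "path_image \<gamma> \<subseteq> ?T" "pathstart \<gamma> = numbered_vec N ix (shifted_packing S (N - ?M))"
      "pathfinish \<gamma> = numbered_vec N ix (shifted_packing S 0)"
      using path_component_shifted_packing[OF ix S, of "N - ?M"] MN by (auto simp: path_component_def)
    \<comment> \<open>The path starts below all clamped vectors and ends above them, so the maximum
      moves from \<open>clamp t\<close> to a constant.\<close>
    define h where "h = (\<lambda>(s, t). \<chi> i. max (clamp t $ i) (\<gamma> s $ i))"
    have cont: "continuous_on ({0..1} \<times> ?T) h"
    proof -
      have "continuous_on ({0..1} \<times> ?T) (\<lambda>x. \<gamma> (fst x))"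
        using \<gamma>(1) unfolding path_def by (rule continuous_on_compose2) (auto intro: continuous_intros)
      moreover have "continuous_on ({0..1} \<times> ?T) (\<lambda>x. clamp (snd x))"
        using cont_clamp[of UNIV] by (rule continuous_on_compose2) (auto intro: continuous_intros)
      ultimately show ?thesis unfolding h_def case_prod_unfold by (intro continuous_intros)
    qed
    have h_T: "h (s, t) \<in> ?T" if "s \<in> {0..1}" "t \<in> ?T" for s t
      using \<gamma>(2) clamp_T[OF that(2)] that(1) unfolding h_def
      by (auto intro!: adapted_vecs_max simp: path_image_def)
    have h0: "h (0, t) = clamp t" if "t \<in> ?T" for t
    proof -
      have "\<gamma> 0 $ i \<le> clamp t $ i" for i
      proof -
        obtain j where j: "j \<in> {1..N}" "i = ix j" using index_cases[OF ix] .
        have t: "adapted N S (\<lambda>j. clamp t $ ix j)" using clamp_T[OF that] by (simp add: adapted_vecs_def)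
        have "shifted_packing S (N - ?M) j \<le> clamp t $ ix j"
        proof (cases "j - (N - ?M) \<le> 1")
          case True
          then have "shifted_packing S (N - ?M) j = lo" by (simp add: shifted_packing_def lo_def max_def)
          then show ?thesis by (simp add: clamp_def)
        next
          case False
          then have "N - j < ?M" "N - j < N" "?M - (N - j) = j - (N - ?M)" "N - (N - j) = j"
            using j(1) MN by auto
          then show ?thesis using adapted_ge_right_packed[OF S(1) t, of "N - j"] False
            by (simp add: shifted_packing_def max_def)
        qed
        then show ?thesis using \<gamma>(3) j numbered_vec_nth[OF ix j(1)] by (simp add: pathstart_def)
      qed
      then show ?thesis by (simp add: h_def vec_eq_iff max_absorb1)
    qed
    have h1: "h (1, t) = numbered_vec N ix (shifted_packing S 0)" if "t \<in> ?T" for t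
    proof -
      have "clamp t $ i \<le> \<gamma> 1 $ i" for i
      proof -
        obtain j where j: "j \<in> {1..N}" "i = ix j" using index_cases[OF ix] .
        have t: "adapted N S (\<lambda>j. clamp t $ ix j)" using clamp_T[OF that] by (simp add: adapted_vecs_def)
        have "clamp t $ ix j \<le> left_packed S j"
        proof (cases "j \<le> ?M")
          case True
          then show ?thesis using adapted_le_left_packed[OF S(1) t, of j] j by auto
        next
          case False
          then have "left_packed S j = hi" using left_packed_enumeration(4)[OF S(1), of j] by (simp add: hi_def)
          moreover have "lo \<le> hi" using left_packed_mono[OF S(1), of 1 ?M] S(2) by (simp add: lo_def hi_def)
          ultimately show ?thesis by (simp add: clamp_def)
        qed
        moreover have "max 1 j = j" using j(1) by auto
        ultimately show ?thesis
          using \<gamma>(4) j numbered_vec_nth[OF ix j(1)] by (simp add: pathfinish_def shifted_packing_def)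
      qed
      then have "h (1, t) = \<gamma> 1" by (simp add: h_def vec_eq_iff max_def order_antisym)
      then show ?thesis using \<gamma>(4) by (simp add: pathfinish_def)
    qed
    have "prod_topology (top_of_set {0..1}) (top_of_set ?T) = top_of_set ({0..1::real} \<times> ?T)"
      by (simp add: prod_topology_subtopology_eu)
    then show ?thesis
      using cont h_T h0 h1 by (subst homotopic_with) (auto intro!: exI[of _ h])
  qed
  ultimately have "homotopic_with_canon (\<lambda>x. True) ?T ?T id (\<lambda>x. numbered_vec N ix (shifted_packing S 0))"
    by (rule homotopic_with_trans)
  then show ?thesis unfolding contractible_def by blast
qed simp

section \<open>Stratification by critical values\<close>

lemma adapted_gap:
  assumes "adapted N S t" "p \<in> S" "l \<in> {1..<N}"
  shows "p \<le> t l \<or> t (Suc l) \<le> p"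
proof -
  obtain k where k: "k \<in> {1..N}" "t k = p" using adaptedD(2)[OF assms(1,2)] by blast
  have "l \<in> {1..N}" "Suc l \<in> {1..N}" using assms(3) by auto
  then show ?thesis
    using adaptedD(1)[OF assms(1) k(1), of l] adaptedD(1)[OF assms(1) _ k(1), of "Suc l"] k(2)
    by (cases "k \<le> l") auto
qed

lemma adapted_first_last:
  assumes "adapted N S t" "p \<in> S"
  shows "t 1 \<le> p" "p \<le> t N"
proof -
  obtain k where k: "k \<in> {1..N}" "t k = p" using adaptedD(2)[OF assms] by blast
  then show "t 1 \<le> p" "p \<le> t N"
    using adaptedD(1)[OF assms(1), of 1 k] adaptedD(1)[OF assms(1), of k N] by auto
qed

text \<open>Every turning point is a coordinate, so none lies strictly between two consecutive
  coordinates.\<close>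

lemma adapted_zigzag_step:
  assumes "finite S" "adapted N S t" "l \<in> {1..<N}"
  shows "\<exists>g. (g = 1 \<or> g = -1) \<and> (\<forall>x\<in>{t l..t (Suc l)}. zigzag c S x = zigzag c S (t l) + g * (x - t l))"
proof -
  let ?g = "(-1::real) ^ Suc (card {p \<in> S. p \<le> t l})"
  have "zigzag c S x = zigzag c S (t l) + ?g * (x - t l)" if "x \<in> {t l..t (Suc l)}" for x
  proof -
    have "t l \<in> {t l..t (Suc l)}" using that by simp
    then have "zigzag c S x - zigzag c S (t l) = ?g * (x - t l)"
      using adapted_gap[OF assms(2) _ assms(3)] that by (intro zigzag_gap[OF assms(1)])
    then show ?thesis by linarith
  qed
  moreover have "?g = 1 \<or> ?g = -1" by (simp add: minus_one_power_iff)
  ultimately show ?thesis by blast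
qed

text \<open>The slopes are \<open>1\<close> or \<open>-1\<close>, so the absolute increments of the
  values are the increments of \<open>t\<close>; the branch \<open>c - t\<close> left of
  \<open>S\<close> determines \<open>t 1\<close>. The formula is continuous in the values and
  inverts the parametrisation.\<close>

lemma adapted_unfold:
  assumes "finite S" "adapted N S t" "j \<in> {1..N}"
  shows "t j = c - zigzag c S (t 1) + (\<Sum>l = 1..<j. \<bar>zigzag c S (t (Suc l)) - zigzag c S (t l)\<bar>)"
proof -
  have "\<bar>zigzag c S (t (Suc l)) - zigzag c S (t l)\<bar> = t (Suc l) - t l" if "l \<in> {1..<j}" for l
  proof -
    have l: "l \<in> {1..<N}" using that assms(3) by auto
    have le: "t l \<le> t (Suc l)" using l by (intro adaptedD(1)[OF assms(2)]) auto
    obtain g where g: "g = 1 \<or> g = -1"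
      "\<forall>x\<in>{t l..t (Suc l)}. zigzag c S x = zigzag c S (t l) + g * (x - t l)"
      using adapted_zigzag_step[OF assms(1,2) l, of c] by blast
    have "zigzag c S (t (Suc l)) - zigzag c S (t l) = g * (t (Suc l) - t l)"
      using g(2)[rule_format, of "t (Suc l)"] le by simp
    then show ?thesis using g(1) le by auto
  qed
  then have "(\<Sum>l = 1..<j. \<bar>zigzag c S (t (Suc l)) - zigzag c S (t l)\<bar>) = (\<Sum>l = 1..<j. t (Suc l) - t l)"
    by (intro sum.cong) auto
  also have "\<dots> = t j - t 1" using assms(3) by (subst sum_Suc_diff') auto
  finally show ?thesis using zigzag_left[of S "t 1" c] adapted_first_last[OF assms(2)] by simp
qed

section \<open>Existence and uniqueness of the zigzag presentation\<close>

lemma adapted_extend: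
  assumes "adapted n S t" "1 \<le> n" "t n \<le> x"
  shows "adapted (Suc n) S (t(Suc n := x))"
proof (rule adaptedI)
  fix i j assume "i \<in> {1..Suc n}" "j \<in> {1..Suc n}" "i \<le> j"
  then show "(t(Suc n := x)) i \<le> (t(Suc n := x)) j"
    using adaptedD(1)[OF assms(1), of i j] adaptedD(1)[OF assms(1), of i n] assms(2,3) by (auto simp: le_Suc_eq)
next
  fix p assume "p \<in> S"
  then obtain j where "j \<in> {1..n}" "t j = p" using adaptedD(2)[OF assms(1)] by blast
  then show "\<exists>j\<in>{1..Suc n}. (t(Suc n := x)) j = p" by (intro bexI[of _ j]) auto
qed

lemma adapted_insert_last:
  assumes "adapted n S t" "1 \<le> n"
  shows "adapted n (insert (t n) S) t"
  using assms by (auto simp: adapted_def)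

text \<open>A new turning point is recorded only when the direction actually changes, so
  the last position stays strictly to the right of all turning points.\<close>

lemma zigzag_prefix_exists:
  assumes "1 \<le> n"
  shows "\<exists>S t. finite S \<and> adapted n S t \<and> (\<forall>p\<in>S. p < t n) \<and> (\<forall>j\<in>{1..n}. z j = zigzag c S (t j))"
  using assms
proof (induction n rule: dec_induct)
  case base
  show ?case
    \<comment> \<open>Without turning points the function is \<open>c - t\<close>, which forces this
      position.\<close>
    by (intro exI[of _ "{}"] exI[of _ "\<lambda>_. c - z 1"]) (auto simp: adapted_def zigzag_def mono_on_def)
next
  case (step n)
  then obtain S t where S: "finite S" and t: "adapted n S t" and last: "\<forall>p\<in>S. p < t n"
    and z: "\<forall>j\<in>{1..n}. z j = zigzag c S (t j)" by blast
  define d where "d = z (Suc n) - z n"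
  \<comment> \<open>Unit slopes dictate the distance to the next position; \<open>\<sigma>\<close>
    below is the slope beyond the present turning points.\<close>
  define x where "x = t n + \<bar>d\<bar>"
  define \<sigma> where "\<sigma> = (-1::real) ^ Suc (card S)"
  have \<sigma>: "\<sigma> = 1 \<or> \<sigma> = -1" by (simp add: \<sigma>_def minus_one_power_iff)
  have x: "t n \<le> x" by (simp add: x_def)
  have fx: "zigzag c S x = z n + \<sigma> * \<bar>d\<bar>"
    using zigzag_right[OF S, of "t n" x c] last z step.hyps x by (simp add: \<sigma>_def x_def algebra_simps less_imp_le)
  show ?case
  proof (cases "\<sigma> * \<bar>d\<bar> = d")
    case True
    have "\<forall>j\<in>{1..Suc n}. z j = zigzag c S ((t(Suc n := x)) j)"
      using z fx True by (auto simp: d_def le_Suc_eq)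
    moreover have "\<forall>p\<in>S. p < (t(Suc n := x)) (Suc n)" using last x by auto
    ultimately show ?thesis using S adapted_extend[OF t step.hyps(1) x] by blast
  next
    case False
    then have d: "d \<noteq> 0" "- \<sigma> * \<bar>d\<bar> = d" using \<sigma> by (auto simp: abs_if split: if_splits)
    let ?S = "insert (t n) S"
    have ins: "zigzag c ?S y = zigzag c S y - 2 * \<sigma> * max 0 (y - t n)" for y
      using zigzag_insert[OF S, of "t n" c y] last by (simp add: \<sigma>_def)
    have "z j = zigzag c ?S (t j)" if "j \<in> {1..n}" for j
    proof -
      have "t j \<le> t n" using that by (intro adaptedD(1)[OF t]) auto
      then show ?thesis using z that ins by simp
    qed
    moreover have "z (Suc n) = zigzag c ?S x"
      using ins[of x] fx d by (simp add: x_def d_def)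
    ultimately have "\<forall>j\<in>{1..Suc n}. z j = zigzag c ?S ((t(Suc n := x)) j)"
      by (auto simp: le_Suc_eq)
    moreover have "\<forall>p\<in>?S. p < (t(Suc n := x)) (Suc n)" using d(1) last by (auto simp: x_def)
    moreover have "finite ?S" using S by simp
    ultimately show ?thesis
      using adapted_extend[OF adapted_insert_last[OF t step.hyps(1)] step.hyps(1) x] by blast
  qed
qed

text \<open>The prefix construction leaves the parity open. If it is even, turning at
  \<open>t N\<close> repairs it without changing any value, because no coordinate lies further
  right.\<close>

lemma zigzag_exists:
  assumes "1 \<le> N"
  obtains c S t where "finite S" "odd (card S)" "adapted N S t" "\<And>j. j \<in> {1..N} \<Longrightarrow> z j = zigzag c S (t j)"
proof -
  obtain S t where S: "finite S" and t: "adapted N S t" and last: "\<forall>p\<in>S. p < t N"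
    and z: "\<forall>j\<in>{1..N}. z j = zigzag 0 S (t j)"
    using zigzag_prefix_exists[OF assms, of z 0] by blast
  show thesis
  proof (cases "odd (card S)")
    case True
    then show ?thesis using that S t z by blast
  next
    case False
    let ?S = "insert (t N) S"
    have "t N \<notin> S" using last by auto
    then have "odd (card ?S)" using S False by simp
    moreover have "z j = zigzag 0 ?S (t j)" if "j \<in> {1..N}" for j
    proof -
      have "t j \<le> t N" using that by (intro adaptedD(1)[OF t]) auto
      then show ?thesis using zigzag_insert[OF S, of "t N" 0 "t j"] last z that by simp
    qed
    ultimately show ?thesis using that[of ?S t 0] S adapted_insert_last[OF t assms] by blast
  qed
qed

text \<open>By \<open>adapted_unfold\<close> the values determine the increments of
  \<open>t\<close>, so \<open>t'\<close> is a translate of \<open>t\<close>. Both functions are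
  linear between consecutive coordinates and agree there; outside, the slopes are \<open>-1\<close>
  and, by odd parity, \<open>+1\<close>. The turning points then correspond by
  \<open>zigzag_turning_iff\<close>.\<close>

lemma zigzag_unique:
  assumes N: "1 \<le> N" and S: "finite S" "odd (card S)" "finite S'" "odd (card S')"
    and t: "adapted N S t" "adapted N S' t'"
    and eq: "\<And>j. j \<in> {1..N} \<Longrightarrow> zigzag c S (t j) = zigzag c' S' (t' j)"
  obtains d where "\<And>x. zigzag c S x = zigzag c' S' (x + d)" "\<And>p. p \<in> S \<longleftrightarrow> p + d \<in> S'"
proof -
  let ?f = "zigzag c S" and ?f' = "zigzag c' S'"
  define d where "d = t' 1 - t 1"
  have t': "t' j = t j + d" if "j \<in> {1..N}" for j
  proof -
    have "(\<Sum>l = 1..<j. \<bar>?f (t (Suc l)) - ?f (t l)\<bar>) = (\<Sum>l = 1..<j. \<bar>?f' (t' (Suc l)) - ?f' (t' l)\<bar>)"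
      using that by (intro sum.cong) (auto simp: eq)
    then show ?thesis
      using adapted_unfold[OF S(1) t(1) that, of c] adapted_unfold[OF S(3) t(2) that, of c']
        adapted_unfold[OF S(1) t(1), of 1 c] adapted_unfold[OF S(3) t(2), of 1 c'] N by (simp add: d_def)
  qed
  have f: "?f x = ?f' (x + d)" for x
  proof -
    consider "x \<le> t 1" | "t N \<le> x" | "t 1 < x" "x < t N" by linarith
    then show ?thesis
    proof cases
      case 1
      have "?f y = c - y" if "y \<le> t 1" for y
        using zigzag_left[of S y c] adapted_first_last(1)[OF t(1)] that by force
      moreover have "?f' y = c' - y" if "y \<le> t' 1" for y
        using zigzag_left[of S' y c'] adapted_first_last(1)[OF t(2)] that by force
      ultimately show ?thesis using 1 eq[of 1] t'[of 1] N by simp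
    next
      case 2
      have "?f x = ?f (t N) + (x - t N)"
        using zigzag_right[OF S(1), of "t N" x c] adapted_first_last(2)[OF t(1)] 2 S(2) by simp
      moreover have "?f' (x + d) = ?f' (t' N) + (x + d - t' N)"
        using zigzag_right[OF S(3), of "t' N" "x + d" c'] adapted_first_last(2)[OF t(2)] 2 S(4) t'[of N] N by simp
      ultimately show ?thesis using eq[of N] t'[of N] N by simp
    next
      case 3
      let ?A = "{l \<in> {1..N}. t l \<le> x}"
      \<comment> \<open>Choosing the last such index gives \<open>t l < t (Suc l)\<close> even when
        coordinates repeat, so that the slopes can be compared.\<close>
      define l where "l = Max ?A"
      have "1 \<in> ?A" using 3 N by simp
      then have l: "l \<in> ?A" unfolding l_def by (intro Max_in) auto
      have "l \<noteq> N" using l 3 by auto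
      then have lN: "l \<in> {1..<N}" using l by auto
      have "Suc l \<notin> ?A"
      proof
        assume "Suc l \<in> ?A"
        then have "Suc l \<le> Max ?A" by (intro Max_ge) auto
        then show False unfolding l_def[symmetric] by simp
      qed
      then have x: "t l \<le> x" "x < t (Suc l)" using l lN by auto
      obtain g where g: "\<And>y. y \<in> {t l..t (Suc l)} \<Longrightarrow> ?f y = ?f (t l) + g * (y - t l)"
        using adapted_zigzag_step[OF S(1) t(1) lN, of c] by blast
      obtain g' where g': "\<And>y. y \<in> {t' l..t' (Suc l)} \<Longrightarrow> ?f' y = ?f' (t' l) + g' * (y - t' l)"
        using adapted_zigzag_step[OF S(3) t(2) lN, of c'] by blast
      have lS: "l \<in> {1..N}" "Suc l \<in> {1..N}" using lN by auto
      have "g * (t (Suc l) - t l) = g' * (t (Suc l) - t l)"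
        using g[of "t (Suc l)"] g'[of "t' (Suc l)"] x eq[OF lS(1)] eq[OF lS(2)] t'[OF lS(1)] t'[OF lS(2)] by simp
      then have "g = g'" using x by simp
      then show ?thesis
        using g[of x] g'[of "x + d"] x eq[OF lS(1)] t'[OF lS(1)] t'[OF lS(2)] by simp
    qed
  qed
  have "p \<in> S \<longleftrightarrow> p + d \<in> S'" for p
    unfolding zigzag_turning_iff[OF S(1), of p c] zigzag_turning_iff[OF S(3), of "p + d" c'] f
    by (simp add: algebra_simps)
  with f show thesis using that by blast
qed

section \<open>Strata: homeomorphism type, closedness and disjointness\<close>

definition zigzag_stratum :: "nat \<Rightarrow> (nat \<Rightarrow> 'n::finite) \<Rightarrow> real \<Rightarrow> real set \<Rightarrow> (real ^ 'n) set" where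
  "zigzag_stratum N ix c S = (\<lambda>t. \<chi> i. zigzag c S (t $ i)) ` adapted_vecs N ix S"

lemma zigzag_stratum_iff:
  assumes ix: "bij_betw ix {1..N} (UNIV :: 'n::finite set)"
  shows "z \<in> zigzag_stratum N ix c S \<longleftrightarrow>
    (\<exists>t. adapted N S t \<and> (\<forall>j\<in>{1..N}. z $ ix j = zigzag c S (t j)))"
proof
  assume "z \<in> zigzag_stratum N ix c S"
  then show "\<exists>t. adapted N S t \<and> (\<forall>j\<in>{1..N}. z $ ix j = zigzag c S (t j))"
    by (auto simp: zigzag_stratum_def adapted_vecs_def)
next
  assume "\<exists>t. adapted N S t \<and> (\<forall>j\<in>{1..N}. z $ ix j = zigzag c S (t j))"
  then obtain t where t: "adapted N S t" "\<forall>j\<in>{1..N}. z $ ix j = zigzag c S (t j)" by blast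
  have "z $ i = zigzag c S (numbered_vec N ix t $ i)" for i
    using index_cases[OF ix, of i] t(2) numbered_vec_nth[OF ix] by metis
  then have "z = (\<chi> i. zigzag c S (numbered_vec N ix t $ i))" by (simp add: vec_eq_iff)
  then show "z \<in> zigzag_stratum N ix c S"
    unfolding zigzag_stratum_def using t(1) numbered_vec_adapted_iff[OF ix] by blast
qed

lemma zigzag_stratum_homeomorphic:
  assumes ix: "bij_betw ix {1..N} (UNIV :: 'n::finite set)" and S: "finite S"
  shows "zigzag_stratum N ix c S homeomorphic adapted_vecs N ix S" (is ?hom)
    and "closed (zigzag_stratum N ix c S)" (is ?closed)
proof -
  define F where "F t = (\<chi> i. zigzag c S (t $ i))" for t :: "real ^ 'n"
  define G where "G z = numbered_vec N ix
    (\<lambda>j. c - z $ ix 1 + (\<Sum>l = 1..<j. \<bar>z $ ix (Suc l) - z $ ix l\<bar>))" for z :: "real ^ 'n"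
  have GF: "G (F t) = t" if "t \<in> adapted_vecs N ix S" for t
  proof -
    have "adapted N S (\<lambda>j. t $ ix j)" using that by (simp add: adapted_vecs_def)
    then have "G (F t) $ ix j = t $ ix j" if "j \<in> {1..N}" for j
      using adapted_unfold[OF S, of N "\<lambda>j. t $ ix j" j c] numbered_vec_nth[OF ix that] that
      by (simp add: G_def F_def)
    then show ?thesis using index_cases[OF ix] by (metis vec_eq_iff)
  qed
  have cont: "continuous_on A F" "continuous_on A G" for A
    unfolding F_def G_def numbered_vec_def by (intro continuous_intros)+
  have st: "zigzag_stratum N ix c S = F ` adapted_vecs N ix S"
    unfolding zigzag_stratum_def F_def ..
  have "homeomorphism (adapted_vecs N ix S) (F ` adapted_vecs N ix S) F G"
    using cont GF unfolding homeomorphism_def by (auto simp: image_image)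
  then show ?hom unfolding st using homeomorphic_def homeomorphic_sym by blast
  \<comment> \<open>As \<open>F\<close> and \<open>G\<close> are continuous on the whole space, both
    conditions are closed.\<close>
  have "F ` adapted_vecs N ix S = {z. G z \<in> adapted_vecs N ix S} \<inter> {z. F (G z) = z}"
    using GF by force
  moreover have "closed {z. G z \<in> adapted_vecs N ix S}"
    using closed_vimage[OF closed_adapted_vecs[OF S] cont(2)[of UNIV]] by (simp add: vimage_def)
  moreover have "closed {z. F (G z) = z}"
    by (intro closed_Collect_eq continuous_on_compose2[OF cont(1)[of UNIV] cont(2)] continuous_intros) auto
  ultimately show ?closed unfolding st by auto
qed

text \<open>A common point makes the two functions translates of each other, and translating by
  \<open>d\<close> turns vectors adapted to \<open>S\<close> into vectors adapted to
  \<open>S'\<close>. By symmetry, strata that meet are equal.\<close>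

lemma zigzag_strata_subset:
  assumes ix: "bij_betw ix {1..N} (UNIV :: 'n::finite set)" and N: "1 \<le> N"
    and S: "finite S" "odd (card S)" "finite S'" "odd (card S')"
    and z: "z \<in> zigzag_stratum N ix c S" "z \<in> zigzag_stratum N ix c' S'"
  shows "zigzag_stratum N ix c S \<subseteq> zigzag_stratum N ix c' S'"
proof
  obtain t t' where t: "adapted N S t" "adapted N S' t'"
    "\<And>j. j \<in> {1..N} \<Longrightarrow> z $ ix j = zigzag c S (t j)"
    "\<And>j. j \<in> {1..N} \<Longrightarrow> z $ ix j = zigzag c' S' (t' j)"
    using z unfolding zigzag_stratum_iff[OF ix] by blast
  have "zigzag c S (t j) = zigzag c' S' (t' j)" if "j \<in> {1..N}" for j
    using t(3,4)[OF that] by simp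
  from zigzag_unique[OF N S t(1,2) this] obtain d where
    d: "\<And>x. zigzag c S x = zigzag c' S' (x + d)" "\<And>p. p \<in> S \<longleftrightarrow> p + d \<in> S'" by metis
  fix y assume "y \<in> zigzag_stratum N ix c S"
  then obtain s where s: "adapted N S s" "\<forall>j\<in>{1..N}. y $ ix j = zigzag c S (s j)"
    unfolding zigzag_stratum_iff[OF ix] by blast
  have "adapted N S' (\<lambda>j. s j + d)"
  proof (rule adaptedI)
    fix i j assume "i \<in> {1..N}" "j \<in> {1..N}" "i \<le> j"
    then show "s i + d \<le> s j + d" using adaptedD(1)[OF s(1)] by simp
  next
    fix p assume "p \<in> S'"
    then have "p - d \<in> S" using d(2)[of "p - d"] by simp
    then obtain j where "j \<in> {1..N}" "s j = p - d" using adaptedD(2)[OF s(1)] by blast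
    then show "\<exists>j\<in>{1..N}. s j + d = p" by (intro bexI[of _ j]) auto
  qed
  moreover have "\<forall>j\<in>{1..N}. y $ ix j = zigzag c' S' (s j + d)" using s(2) d(1) by simp
  ultimately show "y \<in> zigzag_stratum N ix c' S'"
    unfolding zigzag_stratum_iff[OF ix] by blast
qed

section \<open>The components of a fibre\<close>

lemma components_Union_finite_closed:
  fixes \<D> :: "'a::topological_space set set"
  assumes "finite \<D>" "pairwise disjnt \<D>"
    and D: "\<And>X. X \<in> \<D> \<Longrightarrow> closed X" "\<And>X. X \<in> \<D> \<Longrightarrow> connected X" "\<And>X. X \<in> \<D> \<Longrightarrow> X \<noteq> {}"
  shows "components (\<Union>\<D>) = \<D>"
proof -
  have comp: "X \<in> components (\<Union>\<D>)" if X: "X \<in> \<D>" for X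
    unfolding in_components_maximal
  proof (intro conjI allI impI)
    fix d assume d: "d \<noteq> {} \<and> X \<subseteq> d \<and> d \<subseteq> \<Union>\<D> \<and> connected d"
    let ?R = "\<Union>(\<D> - {X})"
    have "X \<inter> ?R = {}" using assms(2) X by (fastforce simp: pairwise_def disjnt_def)
    moreover have "closed ?R" using assms(1) D(1) by (intro closed_Union) auto
    moreover have "X \<inter> d \<noteq> {}" using d D(3)[OF X] by auto
    \<comment> \<open>Otherwise the disjoint closed sets \<open>X\<close> and \<open>?R\<close>
      would split the connected set \<open>d\<close>.\<close>
    ultimately have "?R \<inter> d = {}"
      using connected_closedD[of d X ?R] d D(1)[OF X] by blast
    then show "d = X" using d by blast
  qed (use D X in auto)
  show ?thesis
  proof (intro equalityI subsetI)
    fix C assume C: "C \<in> components (\<Union>\<D>)"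
    obtain x X where "x \<in> C" "X \<in> \<D>" "x \<in> X"
      using in_components_nonempty[OF C] in_components_subset[OF C] by blast
    then have "C = X" using components_nonoverlap[OF C comp[of X]] by blast
    then show "C \<in> \<D>" using \<open>X \<in> \<D>\<close> by simp
  qed (use comp in blast)
qed

theorem theorem1p3:
  fixes N :: nat and ix :: "nat \<Rightarrow> 'n::finite" and P :: diagram
  assumes "N \<ge> 1"
    and "CARD('n) = N"
    and "bij_betw ix {1..N} (UNIV :: 'n set)"
    and "P \<in> Per"
  defines "D \<equiv> data_space TYPE('k::field) ix P"
  shows "finite (components D) \<and> \<Union>(components D) = D \<and> pairwise disjnt (components D)
    \<and> (\<forall>C \<in> components D. contractible C
        \<and> (\<exists>\<F> :: (real ^ 'n) set set.
              finite \<F> \<and> (\<forall>T \<in> \<F>. polyhedron T) \<and> C homeomorphic \<Union>\<F>))"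
proof -
  note ix = assms(3)
  have D: "z \<in> D \<longleftrightarrow> Dgm TYPE('k) N (\<lambda>j. z $ ix j) = P" for z
    using assms(2) by (simp add: D_def data_space_def)
  \<comment> \<open>Translated functions describe the same stratum; collecting sets rather than
    pairs \<open>(c, S)\<close> identifies them, which finiteness requires.\<close>
  define \<D> where "\<D> = {zigzag_stratum N ix c S | c S. finite S \<and> odd (card S) \<and> zigzag_stratum N ix c S \<inter> D \<noteq> {}}"
  have stratum_D: "zigzag_stratum N ix c S \<subseteq> D"
    if "finite S" "odd (card S)" "zigzag_stratum N ix c S \<inter> D \<noteq> {}" for c S
  proof
    fix y assume y: "y \<in> zigzag_stratum N ix c S"
    obtain z where z: "z \<in> zigzag_stratum N ix c S" "z \<in> D"
      using \<open>zigzag_stratum N ix c S \<inter> D \<noteq> {}\<close> by blast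
    obtain s t where "adapted N S s" "\<forall>j\<in>{1..N}. y $ ix j = zigzag c S (s j)"
      "adapted N S t" "\<forall>j\<in>{1..N}. z $ ix j = zigzag c S (t j)"
      using y z(1) unfolding zigzag_stratum_iff[OF ix] by blast
    then have "Dgm TYPE('k) N (\<lambda>j. y $ ix j) = Dgm TYPE('k) N (\<lambda>j. z $ ix j)"
      using that by (intro Dgm_adapted_eq[of S N s t]) auto
    then show "y \<in> D" using z(2) by (simp add: D)
  qed
  have Union: "\<Union>\<D> = D"
  proof (intro equalityI subsetI)
    fix z assume z: "z \<in> D"
    obtain c S t where cS: "finite S" "odd (card S)" "adapted N S t"
      "\<And>j. j \<in> {1..N} \<Longrightarrow> z $ ix j = zigzag c S (t j)"
      using zigzag_exists[OF assms(1), of "\<lambda>j. z $ ix j"] by metis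
    then have "z \<in> zigzag_stratum N ix c S" unfolding zigzag_stratum_iff[OF ix] by blast
    then show "z \<in> \<Union>\<D>" using z cS unfolding \<D>_def by blast
  next
    fix z assume "z \<in> \<Union>\<D>"
    then show "z \<in> D" using stratum_D unfolding \<D>_def by blast
  qed
  have meet: "X = Y" if "X \<in> \<D>" "Y \<in> \<D>" "z \<in> X" "z \<in> Y" for X Y z
    using that zigzag_strata_subset[OF ix assms(1)] unfolding \<D>_def by (blast intro: equalityI)
  \<comment> \<open>An infinite death time becomes \<open>0\<close> here; \<open>V\<close> stays
    finite.\<close>
  define V where "V = fst ` set_mset P \<union> real_of_ereal ` snd ` set_mset P"
  define K where "K = {y :: real ^ 'n. \<forall>i. y $ i \<in> V}"
  have "finite K"
  proof -
    have "finite ((\<lambda>f. \<chi> i. f i) ` (UNIV \<rightarrow>\<^sub>E V) :: (real ^ 'n) set)"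
      by (intro finite_imageI finite_PiE) (auto simp: V_def)
    moreover have "K \<subseteq> (\<lambda>f. \<chi> i. f i) ` (UNIV \<rightarrow>\<^sub>E V)"
    proof
      fix y assume "y \<in> K"
      then have "y = (\<chi> i. (\<lambda>i. y $ i) i)" "(\<lambda>i. y $ i) \<in> UNIV \<rightarrow>\<^sub>E V" by (auto simp: K_def)
      then show "y \<in> (\<lambda>f. \<chi> i. f i) ` (UNIV \<rightarrow>\<^sub>E V)" by blast
    qed
    ultimately show ?thesis by (rule finite_subset[rotated])
  qed
  \<comment> \<open>The left-packed vector belongs to the stratum, and all its coordinates are
    critical values, hence lie in \<open>V\<close>.\<close>
  have "\<exists>y. y \<in> X \<and> y \<in> K" if X: "X \<in> \<D>" for X
  proof -
    obtain c S where cS: "X = zigzag_stratum N ix c S" "finite S" "odd (card S)" "X \<inter> D \<noteq> {}"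
      using X unfolding \<D>_def by blast
    then have "card S \<le> N" using adapted_card_le unfolding zigzag_stratum_iff[OF ix] cS(1)
      by (metis (no_types, lifting) disjoint_iff zigzag_stratum_iff[OF ix])
    let ?t = "left_packed S"
    have ne: "card S \<noteq> 0" using cS(3) by (cases "card S") auto
    define y where "y = numbered_vec N ix (\<lambda>j. zigzag c S (?t j))"
    have y: "y $ ix j = zigzag c S (?t j)" if "j \<in> {1..N}" for j
      unfolding y_def by (rule numbered_vec_nth[OF ix that])
    have "adapted N S ?t"
    proof -
      have "adapted N S (shifted_packing S 0)"
        using \<open>card S \<le> N\<close> ne by (intro adapted_shifted_packing cS) auto
      moreover have "shifted_packing S 0 j = ?t j" if "j \<in> {1..N}" for j
        using that by (auto simp: shifted_packing_def max_def)
      ultimately show ?thesis using adapted_cong by metis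
    qed
    then have yX: "y \<in> X" unfolding cS(1) zigzag_stratum_iff[OF ix] using y by blast
    then have "y \<in> D" using stratum_D[OF cS(2,3)] cS(1,4) by blast
    then have P: "Dgm TYPE('k) N (\<lambda>j. y $ ix j) = P" by (simp add: D)
    have "y $ i \<in> V" for i
    proof -
      obtain j where j: "j \<in> {1..N}" "i = ix j" using index_cases[OF ix] .
      have "y $ ix j \<in> fst ` set_mset P \<or> ereal (y $ ix j) \<in> snd ` set_mset P"
        using zigzag_left_packed_critical[OF cS(2,3) \<open>card S \<le> N\<close> y j(1), where 'k = 'k] unfolding P .
      then show ?thesis unfolding V_def j(2) by (metis UnI1 UnI2 imageI real_of_ereal.simps(1))
    qed
    then show ?thesis using yX by (auto simp: K_def)
  qed
  \<comment> \<open>Distinct strata are disjoint, so \<open>r\<close> is injective into the finite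
    set \<open>K\<close>.\<close>
  then obtain r where r: "\<And>X. X \<in> \<D> \<Longrightarrow> r X \<in> X \<and> r X \<in> K" by metis
  have "finite \<D>"
  proof (rule inj_on_finite[OF _ _ \<open>finite K\<close>])
    show "inj_on r \<D>" using meet r by (metis inj_onI)
    show "r ` \<D> \<subseteq> K" using r by blast
  qed
  have contr: "contractible X" and poly: "\<exists>\<F> :: (real ^ 'n) set set.
      finite \<F> \<and> (\<forall>T \<in> \<F>. polyhedron T) \<and> X homeomorphic \<Union>\<F>"
    and cl: "closed X" and ne: "X \<noteq> {}" if "X \<in> \<D>" for X
  proof -
    obtain c S where cS: "X = zigzag_stratum N ix c S" "finite S" "odd (card S)" "X \<inter> D \<noteq> {}"
      using \<open>X \<in> \<D>\<close> unfolding \<D>_def by blast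
    note hom = zigzag_stratum_homeomorphic(1)[OF ix cS(2), of c, folded cS(1)]
    have "card S \<noteq> 0" using cS(3) by (cases "card S") auto
    then show "contractible X"
      using homeomorphic_contractible_eq[OF hom] contractible_adapted_vecs[OF ix cS(2)] by blast
    show "closed X" unfolding cS(1) by (rule zigzag_stratum_homeomorphic(2)[OF ix cS(2)])
    show "X \<noteq> {}" using cS(4) by blast
    show "\<exists>\<F> :: (real ^ 'n) set set. finite \<F> \<and> (\<forall>T \<in> \<F>. polyhedron T) \<and> X homeomorphic \<Union>\<F>"
      using hom adapted_vecs_union_polyhedra[OF cS(2), of N ix] by metis
  qed
  have disj: "pairwise disjnt \<D>"
    using meet by (fastforce simp: pairwise_def disjnt_iff)
  have "components D = \<D>"
    unfolding Union[symmetric]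
    using \<open>finite \<D>\<close> disj cl contractible_imp_connected[OF contr] ne
    by (rule components_Union_finite_closed)
  then show ?thesis using \<open>finite \<D>\<close> Union disj contr poly by simp
qed

end
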